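(* There is a polynomial-time algorithm that, given an instance $(V,\mathcal{R},k)$ of \textsc{$k$-BetweennessTour} with $k<|V|/5$, either outputs an edition of $(V,\mathcal{R})$ of size at most $k$ or correctly answers that no such edition exists.
   Context: A betweenness triplet on $\{a,b,c\}$ chooses one of its elements ($abc$ chooses $b$); $\mathcal{R}$ is dense if it contains exactly one triplet on each 3-subset of $V$. A triplet $abc$ is consistent with a linear ordering $\sigma$ of $V$ if $b$ lies between $a$ and $c$; a set of triplets is consistent if some linear ordering is consistent with all of them. \textsc{$k$-BetweennessTour}: given $V$, a dense set $\mathcal{R}$ of betweenness triplets on $V$ and an integer $k$, decide whether some linear ordering of $V$ is consistent with all but at most $k$ triplets of $\mathcal{R}$. An edition is a set $\mathcal{F}\subseteq\mathcal{R}$ such that changing the chosen vertices of the triplets in $\mathcal{F}$ (suitably) yields a consistent set of triplets; its size is $|\mathcal{F}|$. *)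

theory Defs
  imports Complex_Main "HOL-Library.Log_Nat" "HOL-Computational_Algebra.Polynomial"
begin

section \<open>Betweenness triplets and editions\<close>

text \<open>A triplet is stored as its 3-element ground set together with the chosen element, so
  that \<open>abc\<close> and \<open>cba\<close> are the same triplet.\<close>

type_synonym 'v triplet = "'v set \<times> 'v"

definition btw :: "'v \<Rightarrow> 'v \<Rightarrow> 'v \<Rightarrow> 'v triplet" where
  "btw a b c = ({a, b, c}, b)"

definition triplet_on :: "'v set \<Rightarrow> 'v triplet \<Rightarrow> bool" where
  "triplet_on S t \<longleftrightarrow> card S = 3 \<and> fst t = S \<and> snd t \<in> S"

definition dense_triplets :: "'v set \<Rightarrow> 'v triplet set \<Rightarrow> bool" where
  "dense_triplets V R \<longleftrightarrow>
     (\<forall>t\<in>R. \<exists>S\<subseteq>V. triplet_on S t) \<and>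
     (\<forall>S\<subseteq>V. card S = 3 \<longrightarrow> (\<exists>!t. t \<in> R \<and> triplet_on S t))"

definition lies_between :: "'v rel \<Rightarrow> 'v \<Rightarrow> 'v \<Rightarrow> 'v \<Rightarrow> bool" where
  "lies_between \<sigma> a b c \<longleftrightarrow> (a, b) \<in> \<sigma> \<and> (b, c) \<in> \<sigma> \<or> (c, b) \<in> \<sigma> \<and> (b, a) \<in> \<sigma>"

definition consistent_with :: "'v rel \<Rightarrow> 'v triplet \<Rightarrow> bool" where
  "consistent_with \<sigma> t \<longleftrightarrow> (\<exists>a b c. t = btw a b c \<and> distinct [a, b, c] \<and> lies_between \<sigma> a b c)"

definition consistent :: "'v set \<Rightarrow> 'v triplet set \<Rightarrow> bool" where
  "consistent V R \<longleftrightarrow> (\<exists>\<sigma>. linear_order_on V \<sigma> \<and> (\<forall>t\<in>R. consistent_with \<sigma> t))"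

text \<open>Every triplet of an edition is really changed: its new chosen vertex differs from the
  old one.\<close>

definition edition :: "'v set \<Rightarrow> 'v triplet set \<Rightarrow> 'v triplet set \<Rightarrow> bool" where
  "edition V R F \<longleftrightarrow> F \<subseteq> R \<and>
     (\<exists>new. (\<forall>t\<in>F. new t \<in> fst t \<and> new t \<noteq> snd t) \<and>
            consistent V ((R - F) \<union> (\<lambda>t. (fst t, new t)) ` F))"


section \<open>Random access machine programs\<close>

text \<open>
  The instruction set is that of the Cook--Reckhow RAM (constants, addition, subtraction,
  indirect access, output, test for positivity), with structured control flow in place of jumps
  and with the input preloaded into memory. Cells hold integers and are addressed by integers.
  Every instruction and every test costs one step. As there is no multiplication, the bit length
  of the largest absolute value in memory grows by at most one per step, up to the fixed constants
  of the program; hence polynomially many steps in this model amount to polynomial time on a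
  Turing machine.
\<close>

datatype prog =
    Skip
  | Const int int          \<comment> \<open>\<open>x\<^sub>i := c\<close>\<close>
  | Add int int int        \<comment> \<open>\<open>x\<^sub>i := x\<^sub>j + x\<^sub>l\<close>\<close>
  | Sub int int int        \<comment> \<open>\<open>x\<^sub>i := x\<^sub>j - x\<^sub>l\<close>\<close>
  | Load int int           \<comment> \<open>\<open>x\<^sub>i := x[x\<^sub>j]\<close>\<close>
  | Store int int          \<comment> \<open>\<open>x[x\<^sub>i] := x\<^sub>j\<close>\<close>
  | Print int
  | Seq prog prog
  | IfPos int prog prog
  | WhilePos int prog

type_synonym memory = "int \<Rightarrow> int"

text \<open>A state consists of the memory and the words printed so far. In \<open>run c s t s'\<close>,
  the number \<open>t\<close> counts the steps of the terminating execution of \<open>c\<close> from \<open>s\<close> to \<open>s'\<close>.\<close>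

type_synonym state = "memory \<times> int list"

inductive run :: "prog \<Rightarrow> state \<Rightarrow> nat \<Rightarrow> state \<Rightarrow> bool" where
  Skip: "run Skip s 1 s"
| Const: "run (Const i c) (m, out) 1 (m(i := c), out)"
| Add: "run (Add i j l) (m, out) 1 (m(i := m j + m l), out)"
| Sub: "run (Sub i j l) (m, out) 1 (m(i := m j - m l), out)"
| Load: "run (Load i j) (m, out) 1 (m(i := m (m j)), out)"
| Store: "run (Store i j) (m, out) 1 (m(m i := m j), out)"
| Print: "run (Print i) (m, out) 1 (m, out @ [m i])"
| Seq: "run c\<^sub>1 s t\<^sub>1 s' \<Longrightarrow> run c\<^sub>2 s' t\<^sub>2 s'' \<Longrightarrow> run (Seq c\<^sub>1 c\<^sub>2) s (t\<^sub>1 + t\<^sub>2) s''"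
| IfPosTrue: "fst s i > 0 \<Longrightarrow> run c\<^sub>1 s t s' \<Longrightarrow> run (IfPos i c\<^sub>1 c\<^sub>2) s (1 + t) s'"
| IfPosFalse: "\<not> fst s i > 0 \<Longrightarrow> run c\<^sub>2 s t s' \<Longrightarrow> run (IfPos i c\<^sub>1 c\<^sub>2) s (1 + t) s'"
| WhilePosFalse: "\<not> fst s i > 0 \<Longrightarrow> run (WhilePos i c) s 1 s"
| WhilePosTrue: "fst s i > 0 \<Longrightarrow> run c s t\<^sub>1 s' \<Longrightarrow> run (WhilePos i c) s' t\<^sub>2 s'' \<Longrightarrow>
    run (WhilePos i c) s (1 + t\<^sub>1 + t\<^sub>2) s''"

lemma run_deterministic: "run c s t s' \<Longrightarrow> run c s u r \<Longrightarrow> u = t \<and> r = s'"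
proof (induction arbitrary: u r rule: run.induct)
  case (Seq c\<^sub>1 s t\<^sub>1 s' c\<^sub>2 t\<^sub>2 s'')
  from Seq.prems show ?case by cases (metis Seq.IH)
next
  case (IfPosTrue s i c\<^sub>1 t s' c\<^sub>2)
  from IfPosTrue.prems IfPosTrue.hyps(1) show ?case by cases (auto dest!: IfPosTrue.IH)
next
  case (IfPosFalse s i c\<^sub>2 t s' c\<^sub>1)
  from IfPosFalse.prems IfPosFalse.hyps(1) show ?case by cases (auto dest!: IfPosFalse.IH)
next
  case (WhilePosFalse s i c)
  from WhilePosFalse.prems WhilePosFalse.hyps show ?case by cases auto
next
  case (WhilePosTrue s i c t\<^sub>1 s' t\<^sub>2 s'')
  from WhilePosTrue.prems WhilePosTrue.hyps(1) show ?case by cases (simp, metis WhilePosTrue.IH)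
qed (erule run.cases; simp)+

definition load_input :: "int list \<Rightarrow> memory" where
  "load_input ws = (\<lambda>i. if 0 \<le> i \<and> i < int (length ws) then ws ! nat i else 0)"

definition outputs_within :: "prog \<Rightarrow> int list \<Rightarrow> nat \<Rightarrow> int list \<Rightarrow> bool" where
  "outputs_within c ws T out \<longleftrightarrow> (\<exists>t m. t \<le> T \<and> run c (load_input ws, []) t (m, out))"

text \<open>Size of an input in bits: the binary digits of each word, plus one for its sign.\<close>

definition bit_size :: "int list \<Rightarrow> nat" where
  "bit_size ws = (\<Sum>x\<leftarrow>ws. 1 + floorlog 2 (nat \<bar>x\<bar>))"


section \<open>Encoding of instances and answers\<close>

text \<open>Vertices are arbitrary natural numbers. Vertices and triplets may be listed in any order,
  and a triplet may be written as \<open>abc\<close> or \<open>cba\<close>.\<close>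

definition encodes_triplets :: "nat triplet set \<Rightarrow> int list \<Rightarrow> bool" where
  "encodes_triplets R ws \<longleftrightarrow>
     (\<exists>abcs. distinct (map (\<lambda>(a, b, c). btw a b c) abcs) \<and>
             set (map (\<lambda>(a, b, c). btw a b c) abcs) = R \<and>
             ws = int (length abcs) # concat (map (\<lambda>(a, b, c). [int a, int b, int c]) abcs))"

definition encodes_instance :: "nat set \<Rightarrow> nat triplet set \<Rightarrow> int \<Rightarrow> int list \<Rightarrow> bool" where
  "encodes_instance V R k ws \<longleftrightarrow>
     (\<exists>vs us. distinct vs \<and> set vs = V \<and> encodes_triplets R us \<and>
              ws = k # int (length vs) # map int vs @ us)"

definition answers_edition :: "nat triplet set \<Rightarrow> int list \<Rightarrow> bool" where
  "answers_edition F out \<longleftrightarrow> (\<exists>us. encodes_triplets F us \<and> out = 1 # us)"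

definition answers_none :: "int list \<Rightarrow> bool" where
  "answers_none out \<longleftrightarrow> out = [0]"

end

theory Submission imports Defs begin

text \<open>
  An edition of size at most \<open>k < |V|/5\<close> touches at most \<open>3k < |V|\<close> vertices, so some vertex \<open>v\<close> is
  contained in no edited triplet. The triplets through \<open>v\<close> then agree with the target ordering
  \<open>\<sigma>\<close> and determine it up to reversal: whether two vertices lie on the same side of \<open>v\<close>, and, if so,
  which of them is closer to \<open>v\<close>. Hence it suffices to try every \<open>v\<close>, together with every reference
  vertex \<open>u\<close> that fixes the direction: from the triplets through \<open>v\<close> one computes integer keys that
  sort the vertices like \<open>\<sigma>\<close> whenever \<open>v\<close> is untouched, and counts the triplets inconsistent with
  them. The keys are always pairwise distinct, so whatever \<open>v\<close> and \<open>u\<close> are, the inconsistent triplets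
  form an edition.
\<close>

section \<open>Key functions and editions\<close>

text \<open>Distance from \<open>v\<close> is obtained by counting: the triplets with ends
  \<open>v\<close> and \<open>a\<close> are as many as the vertices chosen between them. One pass
  that adds a multiple of \<open>N\<close> to the key of \<open>a\<close> for each such triplet
  therefore ranks the vertices without sorting, and the triplet on \<open>u\<close>,
  \<open>v\<close>, \<open>a\<close> supplies the sign. Testing a triplet only compares three keys,
  so the ordering itself is never written down. For a wrong guess of \<open>v\<close> these counts
  can coincide. The position \<open>i < N\<close> of a vertex in the list is therefore kept as the
  remainder of its key modulo \<open>N\<close>: it separates all keys for every guess, and it is too
  small to disturb the comparison of different multiples of \<open>N\<close>. All this needs only
  addition and subtraction of \<open>N\<close>, which suits a machine without multiplication. Output
  cannot be withdrawn and starts with the number of listed triplets, so the inconsistent triplets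
  are counted in one pass and printed in another.\<close>

fun btw_of :: "'v \<times> 'v \<times> 'v \<Rightarrow> 'v triplet" where
  "btw_of (a, b, c) = btw a b c"

lemma btw_of_eq: "btw_of = (\<lambda>(a, b, c). btw a b c)"
  by auto

lemma lies_between_commute: "lies_between \<sigma> a b c \<longleftrightarrow> lies_between \<sigma> c b a"
  by (auto simp: lies_between_def)

lemma lies_between_converse: "lies_between (\<sigma>\<inverse>) a b c \<longleftrightarrow> lies_between \<sigma> a b c"
  by (auto simp: lies_between_def)

lemma consistent_with_converse: "consistent_with (\<sigma>\<inverse>) t \<longleftrightarrow> consistent_with \<sigma> t"
  by (simp add: consistent_with_def lies_between_converse)

text \<open>A triplet forgets the order of its ends. Distinct entries on the left give a ground set
  of three elements, which forces \<open>p \<noteq> r\<close>, so the ends are recovered as an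
  unordered pair.\<close>

lemma btw_eq_iff:
  assumes "distinct [x, y, z]"
  shows "btw x y z = btw p q r \<longleftrightarrow> y = q \<and> (x = p \<and> z = r \<or> x = r \<and> z = p)"
proof
  assume eq: "btw x y z = btw p q r"
  then have "y = q" and "x \<in> {p, q, r}" "z \<in> {p, q, r}"
    by (auto simp: btw_def)
  moreover have "card {x, y, z} = 3" "{x, y, z} = {p, q, r}"
    using eq assms unfolding btw_def by auto
  then have "p \<noteq> r"
    by (auto simp: card_insert_if split: if_splits)
  ultimately show "y = q \<and> (x = p \<and> z = r \<or> x = r \<and> z = p)"
    using assms by auto
qed (auto simp: btw_def)

lemma consistent_with_btw:
  assumes "distinct [x, y, z]"
  shows "consistent_with \<sigma> (btw x y z) \<longleftrightarrow> lies_between \<sigma> x y z"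
  using assms unfolding consistent_with_def
  by (auto simp: btw_eq_iff lies_between_def)

fun bad :: "('v \<Rightarrow> int) \<Rightarrow> 'v \<times> 'v \<times> 'v \<Rightarrow> bool" where
  "bad K (x, y, z) \<longleftrightarrow> \<not> (K x < K y \<and> K y < K z \<or> K z < K y \<and> K y < K x)"

section \<open>The passes that compute the keys, and the closed form of their result\<close>

lemma length_filter_eq_of_distinct_map:
  assumes "distinct (map f xs)"
  shows "length (filter (\<lambda>t. f t = b) xs) = (if b \<in> f ` set xs then 1 else 0)"
  using assms by (induction xs) (auto simp: filter_empty_conv)

text \<open>The condition recognises the triplet \<open>btw u v a\<close> in either spelling, which
  puts \<open>a\<close> on the side of \<open>v\<close> opposite to \<open>u\<close>. Subtracting
  \<open>2 * N\<close> reflects the starting multiple \<open>N\<close> to \<open>-N\<close>.\<close>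

fun flip :: "'v \<Rightarrow> 'v \<Rightarrow> int \<Rightarrow> 'v \<times> 'v \<times> 'v \<Rightarrow> ('v \<Rightarrow> int) \<Rightarrow> 'v \<Rightarrow> int" where
  "flip v u N (x, y, z) K =
     (\<lambda>a. if y = v \<and> (x = u \<and> z = a \<or> z = u \<and> x = a) then K a - 2 * N else K a)"

text \<open>A triplet with ends \<open>v\<close> and \<open>a\<close> witnesses one vertex between
  them, so \<open>a\<close> moves one unit \<open>N\<close> further away from \<open>v\<close>, on
  the side that the sign of its key records.\<close>

fun push :: "'v \<Rightarrow> int \<Rightarrow> 'v \<times> 'v \<times> 'v \<Rightarrow> ('v \<Rightarrow> int) \<Rightarrow> 'v \<Rightarrow> int" where
  "push v N (x, y, z) K =
     (\<lambda>a. if x = v \<and> z = a \<or> z = v \<and> x = a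
          then K a + (if K a > 0 then N else - N) else K a)"

lemma fold_flip:
  "fold (flip v u N) ts K a =
     K a - 2 * N * int (length (filter (\<lambda>(x, y, z). y = v \<and> (x = u \<and> z = a \<or> z = u \<and> x = a)) ts))"
proof (induction ts arbitrary: K)
  case (Cons t ts)
  then show ?case
    by (cases t, simp add: distrib_left) blast
qed simp

text \<open>With \<open>N \<ge> 0\<close> a push keeps a positive key positive and a nonpositive key
  nonpositive, so the direction can be read off the initial key once and for all.\<close>

lemma fold_push:
  assumes "N \<ge> 0"
  shows "fold (push v N) ts K a =
     K a + (if K a > 0 then N else - N) *
       int (length (filter (\<lambda>(x, y, z). x = v \<and> z = a \<or> z = v \<and> x = a) ts))"
proof (induction ts arbitrary: K)
  case (Cons t ts)
  then show ?case
    using assms by (cases t) (simp add: algebra_simps)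
qed simp

text \<open>The multiples of \<open>N\<close> in a key encode the signed distance from \<open>v\<close>, positive on the side
  of \<open>u\<close>; the initial keys \<open>N + i\<close> with \<open>i < N\<close> break ties.\<close>

definition keys :: "'v \<Rightarrow> 'v \<Rightarrow> int \<Rightarrow> ('v \<times> 'v \<times> 'v) list \<Rightarrow> ('v \<Rightarrow> int) \<Rightarrow> 'v \<Rightarrow> int" where
  "keys v u N ts K = fold (push v N) ts (fold (flip v u N) ts (K(v := K v - N)))"

text \<open>Nothing is fixed outside the list: the cells of other keys may hold anything.\<close>

definition initial :: "'v list \<Rightarrow> ('v \<Rightarrow> int) \<Rightarrow> bool" where
  "initial vs K \<longleftrightarrow> (\<forall>i<length vs. K (vs ! i) = int (length vs) + int i)"

text \<open>Distinctness is required after \<open>btw_of\<close>, because \<open>(a, b, c)\<close>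
  and \<open>(c, b, a)\<close> spell the same triplet and must not be counted twice.\<close>

locale triplet_list =
  fixes vs :: "'v list" and ts :: "('v \<times> 'v \<times> 'v) list"
  assumes vs: "distinct vs"
    and ts: "distinct (map btw_of ts)"
    and dense: "dense_triplets (set vs) (btw_of ` set ts)"
begin

abbreviation "N \<equiv> int (length vs)"
abbreviation "V \<equiv> set vs"
abbreviation "R \<equiv> btw_of ` set ts"

lemma triple:
  assumes "(x, y, z) \<in> set ts"
  shows "distinct [x, y, z]" "x \<in> V" "y \<in> V" "z \<in> V"
proof -
  have "btw x y z \<in> R"
    using assms by force
  then obtain S where "S \<subseteq> V" "triplet_on S (btw x y z)"
    using dense unfolding dense_triplets_def by blast
  then have "card {x, y, z} = 3" "{x, y, z} \<subseteq> V"
    unfolding triplet_on_def btw_def by auto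
  then show "distinct [x, y, z]" "x \<in> V" "y \<in> V" "z \<in> V"
    by (auto simp: card_insert_if split: if_splits)
qed

lemma length_filter_flip:
  "length (filter (\<lambda>(x, y, z). y = v \<and> (x = u \<and> z = a \<or> z = u \<and> x = a)) ts) =
     (if btw u v a \<in> R then 1 else 0)"
proof -
  have "filter (\<lambda>(x, y, z). y = v \<and> (x = u \<and> z = a \<or> z = u \<and> x = a)) ts =
      filter (\<lambda>t. btw_of t = btw u v a) ts"
    by (intro filter_cong) (auto simp: btw_eq_iff dest: triple(1))
  then show ?thesis
    using length_filter_eq_of_distinct_map[OF ts, of "btw u v a"] by simp
qed

text \<open>With both ends fixed, a triplet is determined by its chosen vertex, so triples and
  vertices in between correspond one to one.\<close>

lemma length_filter_push:
  "length (filter (\<lambda>(x, y, z). x = v \<and> z = a \<or> z = v \<and> x = a) ts) =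
     card {y. btw v y a \<in> R}"
proof -
  let ?P = "\<lambda>t. \<exists>y. t = btw v y a"
  have "filter (\<lambda>(x, y, z). x = v \<and> z = a \<or> z = v \<and> x = a) ts = filter (?P \<circ> btw_of) ts"
    by (intro filter_cong) (auto simp: btw_eq_iff dest: triple(1))
  then have "length (filter (\<lambda>(x, y, z). x = v \<and> z = a \<or> z = v \<and> x = a) ts) =
      length (filter ?P (map btw_of ts))"
    by (simp add: filter_map)
  also have "\<dots> = card (set (filter ?P (map btw_of ts)))"
    using ts distinct_card distinct_filter by metis
  also have "set (filter ?P (map btw_of ts)) = (\<lambda>y. btw v y a) ` {y. btw v y a \<in> R}"
  proof -
    have "{t \<in> A. \<exists>y. t = f y} = f ` {y. f y \<in> A}" for A :: "'v triplet set" and f :: "'v \<Rightarrow> 'v triplet"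
      by blast
    then show ?thesis
      by (simp only: set_filter set_map)
  qed
  also have "card \<dots> = card {y. btw v y a \<in> R}"
    by (intro card_image inj_onI) (auto simp: btw_def)
  finally show ?thesis .
qed

lemma btw_not_distinct_notin: "\<not> distinct [p, q, r] \<Longrightarrow> btw p q r \<notin> R"
proof
  assume "\<not> distinct [p, q, r]" "btw p q r \<in> R"
  then obtain x y z where "(x, y, z) \<in> set ts" "btw x y z = btw p q r"
    by auto
  then show False
    using triple(1) btw_eq_iff \<open>\<not> distinct [p, q, r]\<close> by fastforce
qed

text \<open>Since \<open>i < N\<close>, the key of \<open>a \<noteq> v\<close> after the flips is
  \<open>N + i > 0\<close> or \<open>-N + i < 0\<close>, so the flips decide the direction of all
  pushes. No triplet contains \<open>v\<close> twice, hence the key of \<open>v\<close> itself stays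
  at \<open>i\<close>.\<close>

lemma keys_eq:
  assumes "initial vs K" "i < length vs" "vs ! i = a"
  shows "keys v u N ts K a =
    (if a = v then int i
     else if btw u v a \<in> R then int i - N * (1 + int (card {y. btw v y a \<in> R}))
     else int i + N * (1 + int (card {y. btw v y a \<in> R})))"
proof -
  have K: "K a = N + int i"
    using assms by (auto simp: initial_def)
  have "{y. btw v y v \<in> R} = {}" "btw u v v \<notin> R"
    by (auto intro!: btw_not_distinct_notin simp del: image_iff)
  then show ?thesis
    using K assms(2) unfolding keys_def
    by (auto simp: fold_push fold_flip length_filter_flip length_filter_push algebra_simps)
qed

lemma inj_on_keys:
  assumes "initial vs K"
  shows "inj_on (keys v u N ts K) V"
proof (rule inj_onI)
  fix a b assume "a \<in> V" "b \<in> V" and eq: "keys v u N ts K a = keys v u N ts K b"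
  then obtain i j where i: "i < length vs" "vs ! i = a" and j: "j < length vs" "vs ! j = b"
    by (auto simp: in_set_conv_nth)
  \<comment> \<open>All keys are list positions plus multiples of \<open>N\<close>, so the position
    survives as the residue.\<close>
  have *: "keys v u N ts K (vs ! l) mod N = int l" if "l < length vs" for l
  proof -
    have "\<exists>q. keys v u N ts K (vs ! l) = int l + N * q"
      unfolding keys_eq[OF assms that refl]
      by (rule exI[of _ "if vs ! l = v then 0
          else (if btw u v (vs ! l) \<in> R then - 1 else 1) * (1 + int (card {y. btw v y (vs ! l) \<in> R}))"])
        (simp add: algebra_simps)
    then show ?thesis
      using that by auto
  qed
  have "int i = int j"
    using *[OF i(1)] *[OF j(1)] i j eq by simp
  then show "a = b"
    using i j by simp
qed

section \<open>Keys, orderings and editions\<close>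

lemma edition_if_inj:
  assumes "inj_on K V"
  shows "edition V R (btw_of ` set (filter (bad K) ts))"
proof -
  define \<sigma> where "\<sigma> = {(a, b). a \<in> V \<and> b \<in> V \<and> K a \<le> K b}"
  define F where "F = btw_of ` set (filter (bad K) ts)"
  have lin: "linear_order_on V \<sigma>"
    using assms
    unfolding \<sigma>_def linear_order_on_def partial_order_on_def preorder_on_def refl_on_def trans_def
      antisym_def total_on_def
    by (auto dest: inj_onD)
  have between: "consistent_with \<sigma> (btw x y z) \<longleftrightarrow> \<not> bad K (x, y, z)"
    if "distinct [x, y, z]" "x \<in> V" "y \<in> V" "z \<in> V" for x y z
  proof -
    have "K x \<noteq> K y" "K y \<noteq> K z" "K x \<noteq> K z"
      using that assms by (auto dest: inj_onD)
    then show ?thesis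
      using that by (auto simp: consistent_with_btw lies_between_def \<sigma>_def)
  qed
  define new :: "'v triplet \<Rightarrow> 'v" where
    "new = (\<lambda>t. SOME b. b \<in> fst t \<and> consistent_with \<sigma> (fst t, b))"
  have new: "new t \<in> fst t \<and> consistent_with \<sigma> (fst t, new t)" and t_bad: "\<not> consistent_with \<sigma> t"
    if "t \<in> F" for t
  proof -
    from that obtain x y z where t: "(x, y, z) \<in> set ts" "bad K (x, y, z)" "t = btw x y z"
      unfolding F_def by auto
    note xyz = triple[OF t(1)]
    show "\<not> consistent_with \<sigma> t"
      using between[OF xyz] t by simp
    have "K x \<noteq> K y" "K y \<noteq> K z" "K x \<noteq> K z"
      using xyz assms by (auto dest: inj_onD)
    \<comment> \<open>Of three distinct keys one is the median; it is not that of \<open>y\<close>,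
      so choosing \<open>x\<close> or \<open>z\<close> repairs the triplet.\<close>
    then have "\<not> bad K (y, x, z) \<or> \<not> bad K (x, z, y)"
      using t(2) by auto
    then have "consistent_with \<sigma> (btw y x z) \<or> consistent_with \<sigma> (btw x z y)"
      using between[of y x z] between[of x z y] xyz by auto
    moreover have "btw y x z = (fst t, x)" "btw x z y = (fst t, z)"
      using t(3) by (auto simp: btw_def)
    ultimately have "\<exists>b. b \<in> fst t \<and> consistent_with \<sigma> (fst t, b)"
      using t(3) by (auto simp: btw_def)
    then show "new t \<in> fst t \<and> consistent_with \<sigma> (fst t, new t)"
      unfolding new_def by (rule someI_ex)
  qed
  \<comment> \<open>The order \<open>\<sigma>\<close> accepts the ground set with the new choice but
    rejects \<open>t\<close> itself, so the choice really changes.\<close>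
  have "new t \<noteq> snd t" if "t \<in> F" for t
    using new[OF that] t_bad[OF that] by (metis prod.collapse)
  moreover have "consistent_with \<sigma> t" if "t \<in> R - F" for t
  proof -
    from that obtain x y z where t: "(x, y, z) \<in> set ts" "t = btw x y z"
      by auto
    then have "\<not> bad K (x, y, z)"
      using that unfolding F_def by force
    then show ?thesis
      using between[OF triple[OF t(1)]] t by simp
  qed
  ultimately have "\<forall>t\<in>F. new t \<in> fst t \<and> new t \<noteq> snd t"
    "\<forall>t \<in> (R - F) \<union> (\<lambda>t. (fst t, new t)) ` F. consistent_with \<sigma> t"
    using new by blast+
  moreover have "F \<subseteq> R"
    unfolding F_def by (intro image_mono) simp
  ultimately have "edition V R F"
    using lin unfolding edition_def consistent_def by blast
  then show ?thesis
    unfolding F_def .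
qed

text \<open>Triplets through \<open>v\<close> that agree with \<open>\<sigma>\<close> make the count
  in a key the true number of vertices between \<open>v\<close> and the given one, and its sign the
  true side. Comparing signed distances then reproduces \<open>\<sigma>\<close>, with
  \<open>v\<close> at multiple \<open>0\<close> and the side of \<open>u\<close> positive.\<close>

lemma keys_strict_mono:
  assumes lin: "linear_order_on V \<sigma>"
    and v: "v \<in> V" and u: "u \<in> V" "u \<noteq> v" "(v, u) \<in> \<sigma>"
    and cons: "\<And>t. t \<in> R \<Longrightarrow> v \<in> fst t \<Longrightarrow> consistent_with \<sigma> t"
    and K: "initial vs K"
    and ab: "(a, b) \<in> \<sigma>" "a \<noteq> b"
  shows "keys v u N ts K a < keys v u N ts K b"
proof -
  have anti: "(q, p) \<notin> \<sigma>" if "(p, q) \<in> \<sigma>" "p \<noteq> q" for p q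
    using lin that unfolding linear_order_on_def partial_order_on_def by (auto dest: antisymD)
  have trans: "(p, r) \<in> \<sigma>" if "(p, q) \<in> \<sigma>" "(q, r) \<in> \<sigma>" for p q r
    using lin that unfolding linear_order_on_def partial_order_on_def preorder_on_def
    by (auto dest: transD)
  have total: "(p, q) \<in> \<sigma> \<or> (q, p) \<in> \<sigma>" if "p \<in> V" "q \<in> V" "p \<noteq> q" for p q
    using lin that unfolding linear_order_on_def total_on_def by auto
  have field: "p \<in> V" "q \<in> V" if "(p, q) \<in> \<sigma>" for p q
    using lin that
    unfolding linear_order_on_def partial_order_on_def preorder_on_def refl_on_def by auto
  have not_both: "\<not> lies_between \<sigma> q p r" if "distinct [p, q, r]" "lies_between \<sigma> p q r" for p q r
    using that anti trans unfolding lies_between_def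
    by (metis distinct_length_2_or_more)
  \<comment> \<open>Density supplies the converse direction: some triplet on these three vertices
    exists, it agrees with \<open>\<sigma>\<close>, and \<open>not_both\<close> leaves only one
    possible middle.\<close>
  have mid: "btw p q r \<in> R \<longleftrightarrow> lies_between \<sigma> p q r"
    if "distinct [p, q, r]" "p \<in> V" "q \<in> V" "r \<in> V" "v \<in> {p, q, r}" for p q r
  proof
    assume "btw p q r \<in> R"
    then have "consistent_with \<sigma> (btw p q r)"
      using cons that by (simp add: btw_def)
    then show "lies_between \<sigma> p q r"
      using that by (simp add: consistent_with_btw)
  next
    assume lb: "lies_between \<sigma> p q r"
    have "card {p, q, r} = 3" "{p, q, r} \<subseteq> V"
      using that by auto
    then obtain t where t: "t \<in> R" "fst t = {p, q, r}"
      using dense unfolding dense_triplets_def triplet_on_def by metis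
    then have "consistent_with \<sigma> t"
      using cons that by simp
    then obtain x y z where xyz: "t = btw x y z" "distinct [x, y, z]" "lies_between \<sigma> x y z"
      unfolding consistent_with_def by auto
    then have eq: "{x, y, z} = {p, q, r}"
      using t by (simp add: btw_def)
    have "y = q"
    proof (rule ccontr)
      assume "y \<noteq> q"
      moreover have "x \<in> {p, q, r}" "y \<in> {p, q, r}" "z \<in> {p, q, r}" "q \<in> {x, y, z}"
        using eq by blast+
      ultimately have "q = x \<and> y = p \<and> z = r \<or> q = x \<and> y = r \<and> z = p \<or>
          q = z \<and> y = p \<and> x = r \<or> q = z \<and> y = r \<and> x = p"
        using xyz(2) by auto
      then show False
        using xyz(3) lb not_both[of p q r] not_both[of r q p] that(1)
          lies_between_commute[of \<sigma> r p q] lies_between_commute[of \<sigma> p r q]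
          lies_between_commute[of \<sigma> p q r]
        by auto
    qed
    then show "btw p q r \<in> R"
      using t xyz eq by (metis btw_def)
  qed
  let ?D = "\<lambda>a. card {y. btw v y a \<in> R}"
  have vin: "{y. btw v y c \<in> R} = {y. y \<noteq> v \<and> y \<noteq> c \<and> lies_between \<sigma> v y c}"
    if "c \<in> V" "c \<noteq> v" for c
  proof -
    have "btw v y c \<in> R \<longleftrightarrow> y \<noteq> v \<and> y \<noteq> c \<and> lies_between \<sigma> v y c" for y
    proof (cases "y \<in> V \<and> y \<noteq> v \<and> y \<noteq> c")
      case True
      then show ?thesis
        using mid[of v y c] that v by auto
    next
      case False
      have "y \<in> V" if "btw v y c \<in> R"
        using that triple by (fastforce simp: btw_def)
      moreover have "y \<in> V" if "lies_between \<sigma> v y c"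
        using that field unfolding lies_between_def by auto
      ultimately show ?thesis
        using False btw_not_distinct_notin[of v y c] by auto
    qed
    then show ?thesis by simp
  qed
  have fin: "finite {y. btw v y c \<in> R}" for c
  proof (rule finite_subset)
    show "{y. btw v y c \<in> R} \<subseteq> V"
      using triple by (fastforce simp: btw_def)
  qed simp
  have D_less: "?D c < ?D d"
    if "c \<noteq> v" "d \<noteq> v" "c \<noteq> d" "(v, c) \<in> \<sigma> \<and> (c, d) \<in> \<sigma> \<or> (d, c) \<in> \<sigma> \<and> (c, v) \<in> \<sigma>" for c d
  proof -
    have "c \<in> V" "d \<in> V"
      using that field by auto
    \<comment> \<open>The nearer vertex \<open>c\<close> is counted for \<open>d\<close> but not for
      itself, which makes the inclusion strict.\<close>
    have "c \<in> {y. btw v y d \<in> R}" "c \<notin> {y. btw v y c \<in> R}"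
      using that vin[OF \<open>d \<in> V\<close>] vin[OF \<open>c \<in> V\<close>] by (auto simp: lies_between_def)
    moreover have "{y. btw v y c \<in> R} \<subseteq> {y. btw v y d \<in> R}"
      unfolding vin[OF \<open>d \<in> V\<close> that(2)] vin[OF \<open>c \<in> V\<close> that(1)] lies_between_def
      using that anti trans by blast
    ultimately show ?thesis
      using fin by (intro psubset_card_mono) auto
  qed
  \<comment> \<open>As \<open>u\<close> comes after \<open>v\<close>, exactly the vertices before
    \<open>v\<close> are separated from \<open>u\<close> by \<open>v\<close>. For
    \<open>c = u\<close> both sides are false.\<close>
  have side: "btw u v c \<in> R \<longleftrightarrow> (c, v) \<in> \<sigma>" if "c \<in> V" "c \<noteq> v" for c
  proof (cases "c = u")
    case True
    then show ?thesis
      using btw_not_distinct_notin[of u v c] anti u by auto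
  next
    case False
    then show ?thesis
      using mid[of u v c] that u v anti[of v u] by (auto simp: lies_between_def)
  qed
  have "a \<in> V" "b \<in> V"
    using field ab by auto
  then obtain i j where i: "i < length vs" "vs ! i = a" and j: "j < length vs" "vs ! j = b"
    by (auto simp: in_set_conv_nth)
  note keys = keys_eq[OF K i, of v u] keys_eq[OF K j, of v u]
  \<comment> \<open>An offset \<open>l < N\<close> cannot make up for one whole multiple of
    \<open>N\<close>.\<close>
  have scaled: "int l + N * p < int l' + N * q" if "l < length vs" "p < q" for l l' and p q :: int
  proof -
    have "N * (p + 1) \<le> N * q"
      using that by (intro mult_left_mono) auto
    then show ?thesis
      using that by (simp add: algebra_simps)
  qed
  consider "a = v" | "b = v" | "a \<noteq> v" "b \<noteq> v" "(a, v) \<in> \<sigma>" "(v, b) \<in> \<sigma>"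
    | "a \<noteq> v" "b \<noteq> v" "(v, a) \<in> \<sigma>" | "a \<noteq> v" "b \<noteq> v" "(b, v) \<in> \<sigma>"
    using total[OF \<open>a \<in> V\<close> v] total[OF \<open>b \<in> V\<close> v] by blast
  then show ?thesis
  proof cases
    case 1
    then have "btw u v b \<notin> R"
      using side[of b] ab anti \<open>b \<in> V\<close> by auto
    then show ?thesis
      using 1 ab keys scaled[OF i(1), of 0 "1 + int (?D b)" j] by simp
  next
    case 2
    then have "btw u v a \<in> R"
      using side[of a] ab \<open>a \<in> V\<close> by auto
    then show ?thesis
      using 2 ab keys scaled[OF i(1), of "- (1 + int (?D a))" 0 j] by (simp add: algebra_simps)
  next
    case 3
    then have "btw u v a \<in> R" "btw u v b \<notin> R"
      using side[of a] side[of b] anti \<open>a \<in> V\<close> \<open>b \<in> V\<close> by auto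
    then show ?thesis
      using 3 keys scaled[OF i(1), of "- (1 + int (?D a))" "1 + int (?D b)" j]
      by (simp add: algebra_simps)
  next
    case 4
    then have "(v, b) \<in> \<sigma>"
      using trans ab by blast
    then have "btw u v a \<notin> R" "btw u v b \<notin> R"
      using 4 side[of a] side[of b] anti \<open>a \<in> V\<close> \<open>b \<in> V\<close> by auto
    moreover have "?D a < ?D b"
      using 4 ab by (intro D_less) auto
    ultimately show ?thesis
      using 4 keys scaled[OF i(1), of "1 + int (?D a)" "1 + int (?D b)" j] by simp
  next
    case 5
    then have "(a, v) \<in> \<sigma>"
      using trans ab by blast
    then have "btw u v a \<in> R" "btw u v b \<in> R"
      using 5 side[of a] side[of b] \<open>a \<in> V\<close> \<open>b \<in> V\<close> by auto
    moreover have "?D b < ?D a"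
      using 5 ab by (intro D_less) auto
    ultimately show ?thesis
      using 5 keys scaled[OF i(1), of "- (1 + int (?D a))" "- (1 + int (?D b))" j]
      by (simp add: algebra_simps)
  qed
qed

lemma exists_untouched_vertex:
  assumes "F \<subseteq> R" "3 * card F < length vs"
  obtains v where "v \<in> V" "\<And>t. t \<in> F \<Longrightarrow> v \<notin> fst t"
proof -
  have "finite F"
    using assms(1) finite_subset by blast
  have "card (\<Union>t\<in>F. fst t) \<le> (\<Sum>t\<in>F. card (fst t))"
    using \<open>finite F\<close> by (rule card_UN_le)
  also have "\<dots> \<le> (\<Sum>t\<in>F. 3)"
    using assms(1) dense unfolding dense_triplets_def triplet_on_def
    by (intro sum_mono) (metis order_refl subsetD)
  also have "\<dots> < card V"
    using assms(2) vs by (simp add: distinct_card)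
  finally have "card (\<Union>t\<in>F. fst t) < card V" .
  moreover have "finite (\<Union>t\<in>F. fst t)"
    using \<open>finite F\<close> assms(1) by (fastforce simp: btw_def)
  ultimately have "\<not> V \<subseteq> (\<Union>t\<in>F. fst t)"
    using card_mono by (metis leD)
  then show ?thesis
    using that by auto
qed

text \<open>Keys sorted like an ordering that realises \<open>F\<close> make no triplet outside
  \<open>F\<close> bad, so at most \<open>card F\<close> triplets are bad. The bound holds for every
  initial key function, hence for whichever one the program happens to build.\<close>

lemma few_bad_if_edition:
  assumes F: "edition V R F" and small: "3 * card F < length vs"
  obtains v u where "v \<in> V" "u \<in> V"
    "\<And>K. initial vs K \<Longrightarrow> length (filter (bad (keys v u N ts K)) ts) \<le> card F"
proof -
  have "F \<subseteq> R"
    using F by (simp add: edition_def)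
  then have "finite F"
    using finite_subset by blast
  obtain v where v: "v \<in> V" "\<And>t. t \<in> F \<Longrightarrow> v \<notin> fst t"
    using exists_untouched_vertex[OF \<open>F \<subseteq> R\<close> small] by blast
  show ?thesis
  proof (cases "V = {v}")
    \<comment> \<open>No second vertex exists, so \<open>u = v\<close> serves: a triple has three
      distinct vertices, hence \<open>ts\<close> is empty.\<close>
    case True
    have "ts = []"
    proof (rule ccontr)
      assume "ts \<noteq> []"
      then obtain x y z where "(x, y, z) \<in> set ts"
        by (metis list.set_intros(1) neq_Nil_conv prod_cases3)
      then show False
        using triple True by fastforce
    qed
    then show ?thesis
      using that v(1) by simp
  next
    case False
    then obtain u where u: "u \<in> V" "u \<noteq> v"
      using v by blast
    obtain new where "consistent V ((R - F) \<union> (\<lambda>t. (fst t, new t)) ` F)"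
      using F unfolding edition_def by auto
    then obtain \<sigma>\<^sub>0 where \<sigma>\<^sub>0: "linear_order_on V \<sigma>\<^sub>0" "\<And>t. t \<in> R - F \<Longrightarrow> consistent_with \<sigma>\<^sub>0 t"
      unfolding consistent_def by (metis Un_iff)
    \<comment> \<open>Consistency is invariant under reversal, so the ordering may be turned to put
      \<open>u\<close> after \<open>v\<close>, the direction in which keys grow.\<close>
    define \<sigma> where "\<sigma> = (if (v, u) \<in> \<sigma>\<^sub>0 then \<sigma>\<^sub>0 else \<sigma>\<^sub>0\<inverse>)"
    have lin: "linear_order_on V \<sigma>"
      using \<sigma>\<^sub>0(1) by (simp add: \<sigma>_def)
    have "(v, u) \<in> \<sigma>"
      using \<sigma>\<^sub>0(1) u v(1) unfolding \<sigma>_def linear_order_on_def total_on_def by auto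
    have cons: "consistent_with \<sigma> t" if "t \<in> R - F" for t
      using \<sigma>\<^sub>0(2)[OF that] by (simp add: \<sigma>_def consistent_with_converse)
    have "length (filter (bad (keys v u N ts K)) ts) \<le> card F" if K: "initial vs K" for K
    proof -
      let ?K = "keys v u N ts K"
      have mono: "?K a < ?K b" if "(a, b) \<in> \<sigma>" "a \<noteq> b" for a b
        using lin v(1) u \<open>(v, u) \<in> \<sigma>\<close> _ K that
        by (rule keys_strict_mono) (use cons v(2) in auto)
      have "btw x y z \<in> F" if t: "(x, y, z) \<in> set ts" "bad ?K (x, y, z)" for x y z
      proof (rule ccontr)
        assume "btw x y z \<notin> F"
        then have "consistent_with \<sigma> (btw x y z)"
          using t by (intro cons) force
        then have "lies_between \<sigma> x y z"
          using triple(1)[OF t(1)] by (simp add: consistent_with_btw)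
        then show False
          using t(2) mono triple(1)[OF t(1)] unfolding lies_between_def by auto
      qed
      then have "btw_of ` set (filter (bad ?K) ts) \<subseteq> F"
        by auto
      then have "card (btw_of ` set (filter (bad ?K) ts)) \<le> card F"
        using \<open>finite F\<close> by (rule card_mono[rotated])
      moreover have "distinct (map btw_of (filter (bad ?K) ts))"
        using ts by (rule distinct_map_filter)
      ultimately show ?thesis
        by (metis distinct_card length_map list.set_map)
    qed
    then show ?thesis
      using that v(1) u(1) by blast
  qed
qed

end

section \<open>Bounded executions\<close>

text \<open>Exact step counts depend on the branches taken; an upper bound composes
  uniformly.\<close>

definition reaches :: "prog \<Rightarrow> state \<Rightarrow> nat \<Rightarrow> state \<Rightarrow> bool" where
  "reaches c s T s' \<longleftrightarrow> (\<exists>t\<le>T. run c s t s')"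

lemma reaches_run: "run c s t s' \<Longrightarrow> reaches c s t s'"
  by (auto simp: reaches_def)

lemma reaches_mono: "reaches c s T s' \<Longrightarrow> T \<le> U \<Longrightarrow> reaches c s U s'"
  unfolding reaches_def by (meson order_trans)

lemma reaches_Seq:
  "reaches c\<^sub>1 s T s' \<Longrightarrow> reaches c\<^sub>2 s' U s'' \<Longrightarrow> reaches (Seq c\<^sub>1 c\<^sub>2) s (T + U) s''"
  unfolding reaches_def by (meson Seq add_mono)

lemma reaches_IfPos:
  assumes "if fst s i > 0 then reaches c\<^sub>1 s T s' else reaches c\<^sub>2 s T s'"
  shows "reaches (IfPos i c\<^sub>1 c\<^sub>2) s (1 + T) s'"
  using assms unfolding reaches_def
  by (metis IfPosFalse IfPosTrue add_left_mono)

text \<open>Code without loops always terminates, has a cost bound computable from its syntax, and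
  can be evaluated by rewriting with \<open>exec\<close>. Induction over rounds is then confined to
  \<open>WhilePos\<close>.\<close>

primrec loop_free :: "prog \<Rightarrow> bool" where
  "loop_free Skip \<longleftrightarrow> True"
| "loop_free (Const i c) \<longleftrightarrow> True"
| "loop_free (Add i j l) \<longleftrightarrow> True"
| "loop_free (Sub i j l) \<longleftrightarrow> True"
| "loop_free (Load i j) \<longleftrightarrow> True"
| "loop_free (Store i j) \<longleftrightarrow> True"
| "loop_free (Print i) \<longleftrightarrow> True"
| "loop_free (Seq c d) \<longleftrightarrow> loop_free c \<and> loop_free d"
| "loop_free (IfPos i c d) \<longleftrightarrow> loop_free c \<and> loop_free d"
| "loop_free (WhilePos i c) \<longleftrightarrow> False"

primrec cost :: "prog \<Rightarrow> nat" where
  "cost Skip = 1"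
| "cost (Const i c) = 1"
| "cost (Add i j l) = 1"
| "cost (Sub i j l) = 1"
| "cost (Load i j) = 1"
| "cost (Store i j) = 1"
| "cost (Print i) = 1"
| "cost (Seq c d) = cost c + cost d"
| "cost (IfPos i c d) = 1 + max (cost c) (cost d)"
| "cost (WhilePos i c) = 0"

text \<open>The value on loops is irrelevant.\<close>

primrec exec :: "prog \<Rightarrow> state \<Rightarrow> state" where
  "exec Skip s = s"
| "exec (Const i c) s = ((fst s)(i := c), snd s)"
| "exec (Add i j l) s = ((fst s)(i := fst s j + fst s l), snd s)"
| "exec (Sub i j l) s = ((fst s)(i := fst s j - fst s l), snd s)"
| "exec (Load i j) s = ((fst s)(i := fst s (fst s j)), snd s)"
| "exec (Store i j) s = ((fst s)(fst s i := fst s j), snd s)"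
| "exec (Print i) s = (fst s, snd s @ [fst s i])"
| "exec (Seq c d) s = exec d (exec c s)"
| "exec (IfPos i c d) s = (if fst s i > 0 then exec c s else exec d s)"
| "exec (WhilePos i c) s = s"

lemma reaches_exec: "loop_free c \<Longrightarrow> reaches c s (cost c) (exec c s)"
proof (induction c arbitrary: s)
  case (Seq c d)
  then show ?case
    using reaches_Seq[of c s "cost c" "exec c s" d "cost d"] by simp
next
  case (IfPos i c d)
  then have "if fst s i > 0 then reaches c s (max (cost c) (cost d)) (exec (IfPos i c d) s)
      else reaches d s (max (cost c) (cost d)) (exec (IfPos i c d) s)"
    using reaches_mono[of c s "cost c" "exec c s"] reaches_mono[of d s "cost d" "exec d s"] by simp
  then show ?case
    using reaches_IfPos[of s i c "max (cost c) (cost d)" "exec (IfPos i c d) s" d] by simp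
qed (cases s; auto intro!: reaches_run run.intros(1-7) simp del: One_nat_def)+

lemma reaches_execI: "loop_free c \<Longrightarrow> exec c s = s' \<Longrightarrow> cost c \<le> T \<Longrightarrow> reaches c s T s'"
  using reaches_exec reaches_mono by blast

text \<open>The test register holds the number of remaining rounds, so there are exactly
  \<open>n\<close> of them; each adds one step for its test, and the last \<open>1\<close> pays for
  the failing test.\<close>

lemma reaches_WhilePos:
  assumes step: "\<And>i s. i < n \<Longrightarrow> I i s \<Longrightarrow> \<exists>s'. reaches c s T s' \<and> I (Suc i) s'"
    and test: "\<And>i s. i \<le> n \<Longrightarrow> I i s \<Longrightarrow> fst s r = int (n - i)"
    and "I 0 s"
  shows "\<exists>s'. reaches (WhilePos r c) s (n * (T + 1) + 1) s' \<and> I n s'"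
proof -
  have "\<exists>s'. reaches (WhilePos r c) s ((n - i) * (T + 1) + 1) s' \<and> I n s'" if "i \<le> n" "I i s" for i s
    using that
  proof (induction "n - i" arbitrary: i s)
    case 0
    then have "\<not> fst s r > 0"
      using test[OF 0(2,3)] by simp
    then have "reaches (WhilePos r c) s 1 s"
      using WhilePosFalse reaches_def by blast
    moreover have "i = n"
      using 0 by simp
    ultimately show ?case
      using 0(3) by (intro exI[of _ s]) simp
  next
    case (Suc j)
    then have "i < n" by simp
    from step[OF this Suc.prems(2)] obtain s' where s': "reaches c s T s'" "I (Suc i) s'"
      by blast
    moreover have "j = n - Suc i" "Suc i \<le> n"
      using Suc by simp_all
    ultimately obtain s'' where s'': "reaches (WhilePos r c) s' (j * (T + 1) + 1) s''" "I n s''"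
      using Suc(1)[of "Suc i" s'] by auto
    obtain t t' where t: "t \<le> T" "run c s t s'"
      and t': "t' \<le> j * (T + 1) + 1" "run (WhilePos r c) s' t' s''"
      using s'(1) s''(1) by (auto simp: reaches_def)
    have "run (WhilePos r c) s (1 + t + t') s''"
      using test[of i s] Suc.prems \<open>i < n\<close> t(2) t'(2) by (intro WhilePosTrue) auto
    moreover have "1 + t + t' \<le> (n - i) * (T + 1) + 1"
      unfolding Suc(2)[symmetric] using t t' by simp
    ultimately show ?case
      using s''(2) unfolding reaches_def by blast
  qed
  from this[of 0 s] show ?thesis
    using \<open>I 0 s\<close> by simp
qed

text \<open>The closing \<open>Skip\<close> costs a step, so a block of \<open>j\<close> one-step
  instructions has cost \<open>j + 1\<close>.\<close>

fun block :: "prog list \<Rightarrow> prog" where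
  "block [] = Skip"
| "block (c # cs) = Seq c (block cs)"

section \<open>The program\<close>

text \<open>The input occupies the addresses from \<open>0\<close> on, registers have small negative addresses, and
  the key of vertex \<open>a\<close> is kept at address \<open>-100 - a\<close>.\<close>

definition addr :: "nat \<Rightarrow> int" where
  "addr a = -100 - int a"

lemma addr_eq_iff [simp]: "addr a = addr b \<longleftrightarrow> a = b"
  by (simp add: addr_def)

lemma addr_neq [simp]: "j > -100 \<Longrightarrow> addr a \<noteq> j" "j > -100 \<Longrightarrow> j \<noteq> addr a"
  by (auto simp: addr_def)

lemma minus_eq_addr [simp]: "-100 - int a = addr a"
  by (simp add: addr_def)

abbreviation "rBase \<equiv> -1 :: int"
abbreviation "rOne \<equiv> -2 :: int"
abbreviation "rPtrV \<equiv> -3 :: int"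
abbreviation "rLeftV \<equiv> -4 :: int"
abbreviation "rPtrU \<equiv> -5 :: int"
abbreviation "rLeftU \<equiv> -6 :: int"
abbreviation "rV \<equiv> -7 :: int"
abbreviation "rU \<equiv> -8 :: int"
abbreviation "rDone \<equiv> -9 :: int"
abbreviation "rPtr \<equiv> -10 :: int"
abbreviation "rLeft \<equiv> -11 :: int"
abbreviation "rX \<equiv> -12 :: int"
abbreviation "rY \<equiv> -13 :: int"
abbreviation "rZ \<equiv> -14 :: int"
abbreviation "rTmp \<equiv> -15 :: int"
abbreviation "rAddr \<equiv> -16 :: int"
abbreviation "rKX \<equiv> -17 :: int"
abbreviation "rKY \<equiv> -18 :: int"
abbreviation "rKZ \<equiv> -19 :: int"
abbreviation "rCount \<equiv> -20 :: int"

text \<open>The cells \<open>0\<close> and \<open>1\<close> hold \<open>k\<close> and the number of vertices, and \<open>rTmp\<close> is clobbered.\<close>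

definition if_eq :: "int \<Rightarrow> int \<Rightarrow> prog \<Rightarrow> prog" where
  "if_eq i j c = block [Sub rTmp i j, IfPos rTmp Skip (block [Sub rTmp j i, IfPos rTmp Skip c])]"

text \<open>The operand \<open>1\<close> is the cell that holds \<open>N\<close>; subtracting it
  twice subtracts \<open>2 * N\<close>.\<close>

definition flip_end :: "int \<Rightarrow> int \<Rightarrow> prog" where
  "flip_end x z = if_eq rY rV (if_eq x rU
     (block [Sub rAddr rBase z, Load rTmp rAddr, Sub rTmp rTmp 1, Sub rTmp rTmp 1, Store rAddr rTmp]))"

definition flip_prog :: prog where
  "flip_prog = block [flip_end rX rZ, flip_end rZ rX]"

definition push_end :: "int \<Rightarrow> int \<Rightarrow> prog" where
  "push_end x z = if_eq x rV
     (block [Sub rAddr rBase z, Load rTmp rAddr, IfPos rTmp (Add rTmp rTmp 1) (Sub rTmp rTmp 1),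
        Store rAddr rTmp])"

definition push_prog :: prog where
  "push_prog = block [push_end rX rZ, push_end rZ rX]"

definition if_bad :: "prog \<Rightarrow> prog" where
  "if_bad c = block
     [Sub rAddr rBase rX, Load rKX rAddr, Sub rAddr rBase rY, Load rKY rAddr,
      Sub rAddr rBase rZ, Load rKZ rAddr, Sub rTmp rKY rKX,
      IfPos rTmp (block [Sub rTmp rKZ rKY, IfPos rTmp Skip c])
        (block [Sub rTmp rKX rKY,
          IfPos rTmp (block [Sub rTmp rKY rKZ, IfPos rTmp Skip c]) c])]"

definition count_prog :: prog where
  "count_prog = if_bad (Add rCount rCount rOne)"

definition print_prog :: prog where
  "print_prog = if_bad (block [Print rX, Print rY, Print rZ])"

text \<open>Adding cell \<open>1\<close> gives the pointer the value \<open>2 + N\<close>, the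
  address of the number of triplets; the triples follow directly after it.\<close>

definition triples_start :: prog where
  "triples_start = block [Const rPtr 2, Add rPtr rPtr 1, Load rLeft rPtr, Add rPtr rPtr rOne]"

definition triples_next :: prog where
  "triples_next = block
     [Load rX rPtr, Add rPtr rPtr rOne, Load rY rPtr, Add rPtr rPtr rOne,
      Load rZ rPtr, Add rPtr rPtr rOne, Sub rLeft rLeft rOne]"

definition for_triples :: "prog \<Rightarrow> prog" where
  "for_triples c = Seq triples_start (WhilePos rLeft (Seq triples_next c))"

definition vertices_start :: "int \<Rightarrow> int \<Rightarrow> prog" where
  "vertices_start p r = block [Const p 2, Const r 0, Add r r 1]"

definition vertices_next :: "int \<Rightarrow> int \<Rightarrow> int \<Rightarrow> prog" where
  "vertices_next p r x = block [Load x p, Add p p rOne, Sub r r rOne]"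

definition for_vertices :: "int \<Rightarrow> int \<Rightarrow> int \<Rightarrow> prog \<Rightarrow> prog" where
  "for_vertices p r x c =
     Seq (vertices_start p r) (WhilePos r (Seq (vertices_next p r x) c))"

definition init_step :: prog where
  "init_step = block [Sub rAddr rBase rX, Store rAddr rTmp, Add rTmp rTmp rOne]"

definition init_prog :: prog where
  "init_prog = Seq (block [Const rTmp 0, Add rTmp rTmp 1]) (for_vertices rPtr rLeft rX init_step)"

definition centre_prog :: prog where
  "centre_prog = block [Sub rAddr rBase rV, Load rTmp rAddr, Sub rTmp rTmp 1, Store rAddr rTmp]"

definition report_prog :: prog where
  "report_prog = Seq (block [Print rOne, Print rCount])
     (Seq (for_triples print_prog) (Const rDone 1))"

text \<open>Only positivity can be tested, hence the test value \<open>k - rCount + 1\<close>,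
  positive exactly when \<open>rCount \<le> k\<close>.\<close>

definition attempt_prog :: prog where
  "attempt_prog = Seq init_prog (Seq centre_prog (Seq (for_triples flip_prog)
     (Seq (for_triples push_prog) (Seq (Const rCount 0) (Seq (for_triples count_prog)
     (Seq (block [Sub rTmp 0 rCount, Add rTmp rTmp rOne]) (IfPos rTmp report_prog Skip)))))))"

text \<open>A loop cannot be left early. Once an edition is printed, \<open>rDone\<close> turns the
  remaining attempts into no-ops and suppresses the final \<open>0\<close>.\<close>

definition main_prog :: prog where
  "main_prog = Seq (block [Const rBase (-100), Const rOne 1])
     (Seq (for_vertices rPtrV rLeftV rV
        (for_vertices rPtrU rLeftU rU (IfPos rDone Skip attempt_prog)))
     (IfPos rDone Skip (block [Const rTmp 0, Print rTmp])))"

section \<open>Correctness of the program\<close>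

definition enc :: "(nat \<times> nat \<times> nat) list \<Rightarrow> int list" where
  "enc ts = concat (map (\<lambda>(a, b, c). [int a, int b, int c]) ts)"

lemma enc_simps [simp]: "enc [] = []" "enc ((a, b, c) # ts) = int a # int b # int c # enc ts"
  "enc (ts @ ts') = enc ts @ enc ts'"
  by (simp_all add: enc_def)

lemma length_enc [simp]: "length (enc ts) = 3 * length ts"
  by (induction ts) auto

lemma enc_nth:
  assumes "i < length ts" "ts ! i = (x, y, z)"
  shows "enc ts ! (3 * i) = int x" "enc ts ! (3 * i + 1) = int y" "enc ts ! (3 * i + 2) = int z"
proof -
  have "enc ts = enc (take i ts) @ int x # int y # int z # enc (drop (Suc i) ts)"
    using id_take_nth_drop[OF assms(1)] assms(2) by (metis enc_simps(2,3))
  moreover have "length (enc (take i ts)) = 3 * i"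
    using assms(1) by simp
  ultimately show "enc ts ! (3 * i) = int x" "enc ts ! (3 * i + 1) = int y"
    "enc ts ! (3 * i + 2) = int z"
    by (simp_all add: nth_append)
qed

definition key_of :: "memory \<Rightarrow> nat \<Rightarrow> int" where
  "key_of m = (\<lambda>a. m (addr a))"

text \<open>The part of a state on which a pass over the triples has a purely functional
  description.\<close>

definition view :: "state \<Rightarrow> (nat \<Rightarrow> int) \<times> int \<times> int list" where
  "view s = (key_of (fst s), fst s rCount, snd s)"

text \<open>Addresses above \<open>-10\<close> are the input, the constants, the registers of the
  two outer loops and \<open>rDone\<close>; everything from \<open>rPtr\<close> down is scratch
  space or a key.\<close>

definition same :: "memory \<Rightarrow> memory \<Rightarrow> bool" where
  "same m m' \<longleftrightarrow> (\<forall>j > -10. m' j = m j)"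

lemma same_trans: "same m m' \<Longrightarrow> same m' m'' \<Longrightarrow> same m m''"
  by (simp add: same_def)

lemma sameD: "same m m' \<Longrightarrow> j > -10 \<Longrightarrow> m' j = m j"
  by (simp add: same_def)

text \<open>Here \<open>205 = 9 + 196\<close>: key initialisation costs \<open>9\<close> per vertex,
  and four passes cost \<open>49\<close> per triplet each. The terms \<open>66 = 61 + 5\<close> and
  \<open>10 = 5 + 5\<close> collect the overhead of the two vertex loops, and
  \<open>12 = 3 + 5 + 4\<close> that of the setup, the outer loop and the final test.\<close>

definition time_poly :: "nat poly" where
  "time_poly = [:12, 10, 66, 205:]"

lemma length_le_bit_size: "length xs \<le> bit_size xs"
  by (induction xs) (auto simp: bit_size_def)

locale encoded_instance = triplet_list vs ts
  for vs :: "nat list" and ts :: "(nat \<times> nat \<times> nat) list" +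
  fixes k :: int
begin

section \<open>Memory layout of an encoded instance\<close>

definition ws :: "int list" where
  "ws = k # N # map int vs @ int (length ts) # enc ts"

definition ready :: "memory \<Rightarrow> bool" where
  "ready m \<longleftrightarrow> (\<forall>j\<ge>0. m j = load_input ws j) \<and> m rBase = -100 \<and> m rOne = 1"

lemma length_ws: "length ws = 3 + length vs + 3 * length ts"
  by (simp add: ws_def)

lemma input:
  "load_input ws 0 = k" "load_input ws 1 = N"
  "load_input ws (2 + N) = int (length ts)"
  by (simp_all add: load_input_def length_ws) (simp_all add: ws_def nth_append nat_add_distrib)

lemma input_vertex: "i < length vs \<Longrightarrow> load_input ws (2 + int i) = int (vs ! i)"
  by (simp add: load_input_def length_ws) (simp add: ws_def nth_append nat_add_distrib)

lemma input_triple: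
  assumes "i < length ts" "ts ! i = (x, y, z)"
  shows "load_input ws (3 + N + 3 * int i) = int x"
    "load_input ws (4 + N + 3 * int i) = int y"
    "load_input ws (5 + N + 3 * int i) = int z"
proof -
  have "load_input ws (3 + N + int l) = enc ts ! l" if "l < 3 * length ts" for l
  proof -
    have "nat (3 + N + int l) = Suc (Suc (length vs + Suc l))"
      by simp
    moreover have "ws ! Suc (Suc (length vs + Suc l)) = enc ts ! l"
      unfolding ws_def by (simp add: nth_append)
    ultimately show ?thesis
      using that by (simp add: load_input_def length_ws)
  qed
  from this[of "3 * i"] this[of "3 * i + 1"] this[of "3 * i + 2"]
  show "load_input ws (3 + N + 3 * int i) = int x"
    "load_input ws (4 + N + 3 * int i) = int y"
    "load_input ws (5 + N + 3 * int i) = int z"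
    using enc_nth[OF assms] assms(1) by (simp_all add: algebra_simps)
qed

lemma ready_cell: "ready m \<Longrightarrow> j \<ge> 0 \<Longrightarrow> m j = load_input ws j"
  by (simp add: ready_def)

lemma ready_simps:
  assumes "ready m"
  shows "m 0 = k" "m 1 = N" "m (2 + N) = int (length ts)" "m rBase = -100" "m rOne = 1"
  using assms input by (simp_all add: ready_def)

lemma ready_same: "ready m \<Longrightarrow> same m m' \<Longrightarrow> ready m'"
  by (simp add: ready_def same_def)

section \<open>Passes over the triples as folds on views\<close>

definition implements ::
  "prog \<Rightarrow> nat \<Rightarrow> nat \<Rightarrow> (nat \<times> nat \<times> nat \<Rightarrow> (nat \<Rightarrow> int) \<times> int \<times> int list \<Rightarrow>
     (nat \<Rightarrow> int) \<times> int \<times> int list) \<Rightarrow> bool" where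
  "implements c v u f \<longleftrightarrow> loop_free c \<and>
     (\<forall>m out x y z. (x, y, z) \<in> set ts \<longrightarrow> ready m \<longrightarrow> m rV = int v \<longrightarrow> m rU = int u \<longrightarrow>
        m rX = int x \<longrightarrow> m rY = int y \<longrightarrow> m rZ = int z \<longrightarrow>
        (case exec c (m, out) of (m', out') \<Rightarrow>
           same m m' \<and> m' rPtr = m rPtr \<and> m' rLeft = m rLeft \<and>
           view (m', out') = f (x, y, z) (view (m, out))))"

lemma implementsD:
  assumes "implements c v u f" "(x, y, z) \<in> set ts" "ready m" "m rV = int v" "m rU = int u"
    "m rX = int x" "m rY = int y" "m rZ = int z" "exec c (m, out) = (m', out')"
  shows "same m m'" "m' rPtr = m rPtr" "m' rLeft = m rLeft"
    "view (m', out') = f (x, y, z) (view (m, out))"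
proof -
  have "case exec c (m, out) of (m', out') \<Rightarrow> same m m' \<and> m' rPtr = m rPtr \<and> m' rLeft = m rLeft \<and>
      view (m', out') = f (x, y, z) (view (m, out))"
    by (rule assms(1)[unfolded implements_def, THEN conjunct2, rule_format]) (rule assms)+
  then show "same m m'" "m' rPtr = m rPtr" "m' rLeft = m rLeft"
    "view (m', out') = f (x, y, z) (view (m, out))"
    using assms(9) by auto
qed

text \<open>The loop invariant says that after \<open>i\<close> rounds the view is the fold over the
  first \<open>i\<close> triples; this reduces reasoning about memory to the list functions treated
  before. A round costs \<open>8\<close> steps for \<open>triples_next\<close>, one for the test,
  and the body.\<close>

lemma reaches_for_triples:
  assumes c: "implements c v u f" and m: "ready m" "m rV = int v" "m rU = int u"
  shows "\<exists>m' out'. reaches (for_triples c) (m, out) (length ts * (cost c + 9) + 6) (m', out') \<and>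
    same m m' \<and> view (m', out') = fold f ts (view (m, out))"
proof -
  define I where "I = (\<lambda>i (s :: state). same m (fst s) \<and> fst s rPtr = 3 + N + 3 * int i \<and>
    fst s rLeft = int (length ts - i) \<and> view s = fold f (take i ts) (view (m, out)))"
  have start: "I 0 (exec triples_start (m, out))"
    using ready_simps[OF m(1)]
    by (simp add: I_def triples_start_def same_def view_def key_of_def)
  have next_step: "\<exists>s'. reaches (Seq triples_next c) s (8 + cost c) s' \<and> I (Suc i) s'"
    if i: "i < length ts" and I: "I i s" for i s
  proof -
    obtain m1 out1 where s: "s = (m1, out1)"
      by (cases s)
    obtain x y z where t: "ts ! i = (x, y, z)"
      by (metis prod_cases3)
    have m1: "same m m1" "m1 rPtr = 3 + N + 3 * int i" "m1 rLeft = int (length ts - i)"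
      "view s = fold f (take i ts) (view (m, out))"
      using I s by (auto simp: I_def)
    have "ready m1"
      using m(1) m1(1) by (rule ready_same)
    define m2 where "m2 = fst (exec triples_next (m1, out1))"
    have exec: "exec triples_next (m1, out1) = (m2, out1)"
      by (simp add: m2_def triples_next_def prod_eq_iff)
    have cells: "m1 (3 + N + 3 * int i) = int x" "m1 (4 + N + 3 * int i) = int y"
      "m1 (5 + N + 3 * int i) = int z"
      using input_triple[OF i t] ready_cell[OF \<open>ready m1\<close>] by simp_all
    have m2: "same m1 m2" "m2 rX = int x" "m2 rY = int y" "m2 rZ = int z"
      "m2 rPtr = 3 + N + 3 * int (Suc i)" "m2 rLeft = int (length ts - Suc i)"
      "view (m2, out1) = view (m1, out1)"
      using cells m1 ready_simps[OF \<open>ready m1\<close>] i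
      by (simp_all add: m2_def triples_next_def same_def view_def key_of_def algebra_simps of_nat_diff)
    have "ready m2"
      using \<open>ready m1\<close> m2(1) by (rule ready_same)
    have "m2 rV = int v" "m2 rU = int u"
      using m sameD[OF same_trans[OF m1(1) m2(1)]] by simp_all
    moreover have "(x, y, z) \<in> set ts"
      using t i by (metis nth_mem)
    moreover obtain m3 out3 where m3: "exec c (m2, out1) = (m3, out3)"
      by fastforce
    ultimately have m3': "same m2 m3" "m3 rPtr = m2 rPtr" "m3 rLeft = m2 rLeft"
        "view (m3, out3) = f (x, y, z) (view (m2, out1))"
      using implementsD[OF c _ \<open>ready m2\<close> _ _ m2(2-4)] by simp_all
    have "I (Suc i) (m3, out3)"
      using m1(4) m2(5-7) m3' same_trans[OF m1(1) same_trans[OF m2(1) m3'(1)]] i t s unfolding I_def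
      by (simp add: take_Suc_conv_app_nth)
    moreover have "reaches triples_next (m1, out1) 8 (m2, out1)"
      using exec by (intro reaches_execI) (simp_all add: triples_next_def)
    moreover have "reaches c (m2, out1) (cost c) (m3, out3)"
      using reaches_exec[of c "(m2, out1)"] c m3 by (simp add: implements_def)
    ultimately show ?thesis
      using reaches_Seq s by blast
  qed
  have "\<exists>s'. reaches (WhilePos rLeft (Seq triples_next c)) (exec triples_start (m, out))
      (length ts * (8 + cost c + 1) + 1) s' \<and> I (length ts) s'"
    by (rule reaches_WhilePos[OF next_step _ start]) (auto simp: I_def)
  then obtain s' where s': "reaches (WhilePos rLeft (Seq triples_next c))
      (exec triples_start (m, out)) (length ts * (8 + cost c + 1) + 1) s'" "I (length ts) s'"
    by blast
  have "reaches triples_start (m, out) 5 (exec triples_start (m, out))"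
    by (intro reaches_execI) (simp_all add: triples_start_def)
  then have "reaches (for_triples c) (m, out) (length ts * (cost c + 9) + 6) s'"
    unfolding for_triples_def
    by (rule reaches_mono[OF reaches_Seq[OF _ s'(1)]]) (simp add: algebra_simps)
  then show ?thesis
    using s'(2) by (cases s') (auto simp: I_def)
qed

section \<open>The four loop bodies\<close>

lemma exec_if_eq:
  assumes "i \<noteq> rTmp" "j \<noteq> rTmp"
  shows "exec (if_eq i j c) (m, out) =
    (if m i = m j then exec c (m(rTmp := 0), out) else (m(rTmp := \<bar>m i - m j\<bar>), out))"
  using assms by (auto simp: if_eq_def)

text \<open>Finer than \<open>same\<close>: between the two halves of a body the loop registers and
  the loaded triple must survive as well, so only \<open>rTmp\<close>, \<open>rAddr\<close> and the
  keys may change.\<close>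

definition frame :: "memory \<Rightarrow> memory \<Rightarrow> bool" where
  "frame m m' \<longleftrightarrow> (\<forall>j > -100. j \<noteq> rTmp \<longrightarrow> j \<noteq> rAddr \<longrightarrow> m' j = m j)"

lemma frame_trans: "frame m m' \<Longrightarrow> frame m' m'' \<Longrightarrow> frame m m''"
  by (simp add: frame_def)

lemma frameD: "frame m m' \<Longrightarrow> j > -100 \<Longrightarrow> j \<noteq> rTmp \<Longrightarrow> j \<noteq> rAddr \<Longrightarrow> m' j = m j"
  by (simp add: frame_def)

lemma frame_same: "frame m m' \<Longrightarrow> same m m'"
  by (simp add: frame_def same_def)

lemma exec_flip_end:
  assumes "ready m" "m rV = int v" "m rU = int u" "x = rX \<and> z = rZ \<or> x = rZ \<and> z = rX"
    "m x = int a" "m rY = int b" "m z = int c"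
  shows "\<exists>m'. exec (flip_end x z) (m, out) = (m', out) \<and> frame m m' \<and>
    key_of m' = (if b = v \<and> a = u then (key_of m)(c := key_of m c - 2 * N) else key_of m)"
  using assms ready_simps[OF assms(1)]
  by (intro exI[of _ "fst (exec (flip_end x z) (m, out))"])
    (elim disjE; simp add: flip_end_def exec_if_eq frame_def key_of_def fun_eq_iff)

lemma exec_push_end:
  assumes "ready m" "m rV = int v" "x = rX \<and> z = rZ \<or> x = rZ \<and> z = rX"
    "m x = int a" "m z = int c"
  shows "\<exists>m'. exec (push_end x z) (m, out) = (m', out) \<and> frame m m' \<and>
    key_of m' = (if a = v then (key_of m)(c := key_of m c + (if key_of m c > 0 then N else - N))
      else key_of m)"
  using assms ready_simps[OF assms(1)]
  by (intro exI[of _ "fst (exec (push_end x z) (m, out))"])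
    (elim disjE; simp add: push_end_def exec_if_eq frame_def key_of_def fun_eq_iff)

lemma implements_flip:
  "implements flip_prog v u (\<lambda>t (K, c, out). (flip v u N t K, c, out))"
  unfolding implements_def
proof (intro conjI allI impI)
  fix m :: memory and out x y z
  assume t: "(x, y, z) \<in> set ts" and m: "ready m" "m rV = int v" "m rU = int u"
    "m rX = int x" "m rY = int y" "m rZ = int z"
  obtain m1 where m1: "exec (flip_end rX rZ) (m, out) = (m1, out)" "frame m m1"
    "key_of m1 = (if y = v \<and> x = u then (key_of m)(z := key_of m z - 2 * N) else key_of m)"
    using exec_flip_end[OF m(1-3), of rX rZ x y z] m by auto
  have "ready m1"
    using ready_same[OF m(1) frame_same[OF m1(2)]] .
  moreover have "m1 rV = int v" "m1 rU = int u" "m1 rX = int x" "m1 rY = int y" "m1 rZ = int z"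
    using m frameD[OF m1(2)] by simp_all
  ultimately obtain m2 where m2: "exec (flip_end rZ rX) (m1, out) = (m2, out)" "frame m1 m2"
    "key_of m2 = (if y = v \<and> z = u then (key_of m1)(x := key_of m1 x - 2 * N) else key_of m1)"
    using exec_flip_end[of m1 v u rZ rX z y x] by auto
  have "frame m m2"
    using m1(2) m2(2) by (rule frame_trans)
  \<comment> \<open>The program treats the two ends in sequence, \<open>flip\<close> simultaneously.
    As the ends are distinct, at most one half fires and the results agree.\<close>
  moreover have "key_of m2 = flip v u N (x, y, z) (key_of m)"
    unfolding m2(3) m1(3) using triple(1)[OF t] by (auto simp: fun_eq_iff)
  ultimately show "case exec flip_prog (m, out) of (m', out') \<Rightarrow>
           same m m' \<and> m' rPtr = m rPtr \<and> m' rLeft = m rLeft \<and>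
           view (m', out') = (case view (m, out) of (K, c, out) \<Rightarrow> (flip v u N (x, y, z) K, c, out))"
    by (simp add: flip_prog_def m1(1) m2(1) view_def frame_same frameD del: flip.simps)
qed (simp add: flip_prog_def flip_end_def if_eq_def)

lemma implements_push:
  "implements push_prog v u (\<lambda>t (K, c, out). (push v N t K, c, out))"
  unfolding implements_def
proof (intro conjI allI impI)
  fix m :: memory and out x y z
  assume t: "(x, y, z) \<in> set ts" and m: "ready m" "m rV = int v" "m rU = int u"
    "m rX = int x" "m rY = int y" "m rZ = int z"
  obtain m1 where m1: "exec (push_end rX rZ) (m, out) = (m1, out)" "frame m m1"
    "key_of m1 = (if x = v then (key_of m)(z := key_of m z + (if key_of m z > 0 then N else - N))
      else key_of m)"
    using exec_push_end[OF m(1,2), of rX rZ x z] m by auto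
  have "ready m1"
    using ready_same[OF m(1) frame_same[OF m1(2)]] .
  moreover have "m1 rV = int v" "m1 rX = int x" "m1 rZ = int z"
    using m frameD[OF m1(2)] by simp_all
  ultimately obtain m2 where m2: "exec (push_end rZ rX) (m1, out) = (m2, out)" "frame m1 m2"
    "key_of m2 = (if z = v then (key_of m1)(x := key_of m1 x + (if key_of m1 x > 0 then N else - N))
      else key_of m1)"
    using exec_push_end[of m1 v rZ rX z x] by auto
  have "frame m m2"
    using m1(2) m2(2) by (rule frame_trans)
  moreover have "key_of m2 = push v N (x, y, z) (key_of m)"
    unfolding m2(3) m1(3) using triple(1)[OF t] by (auto simp: fun_eq_iff)
  ultimately show "case exec push_prog (m, out) of (m', out') \<Rightarrow>
           same m m' \<and> m' rPtr = m rPtr \<and> m' rLeft = m rLeft \<and>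
           view (m', out') = (case view (m, out) of (K, c, out) \<Rightarrow> (push v N (x, y, z) K, c, out))"
    by (simp add: push_prog_def m1(1) m2(1) view_def frame_same frameD del: push.simps)
qed (simp add: push_prog_def push_end_def if_eq_def)

lemma implements_count:
  "implements count_prog v u (\<lambda>t (K, c, out). (K, c + (if bad K t then 1 else 0), out))"
  unfolding implements_def
proof (intro conjI allI impI)
  fix m :: memory and out x y z
  assume "(x, y, z) \<in> set ts" "ready m" "m rV = int v" "m rU = int u"
    "m rX = int x" "m rY = int y" "m rZ = int z"
  then show "case exec count_prog (m, out) of (m', out') \<Rightarrow>
           same m m' \<and> m' rPtr = m rPtr \<and> m' rLeft = m rLeft \<and>
           view (m', out') = (case view (m, out) of (K, c, out) \<Rightarrow>
             (K, c + (if bad K (x, y, z) then 1 else 0), out))"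
    using ready_simps[of m]
    by (auto simp: count_prog_def if_bad_def same_def view_def key_of_def fun_eq_iff)
qed (simp add: count_prog_def if_bad_def)

lemma implements_print:
  "implements print_prog v u (\<lambda>t (K, c, out). (K, c, out @ (if bad K t then enc [t] else [])))"
  unfolding implements_def
proof (intro conjI allI impI)
  fix m :: memory and out x y z
  assume "(x, y, z) \<in> set ts" "ready m" "m rV = int v" "m rU = int u"
    "m rX = int x" "m rY = int y" "m rZ = int z"
  then show "case exec print_prog (m, out) of (m', out') \<Rightarrow>
           same m m' \<and> m' rPtr = m rPtr \<and> m' rLeft = m rLeft \<and>
           view (m', out') = (case view (m, out) of (K, c, out) \<Rightarrow>
             (K, c, out @ (if bad K (x, y, z) then enc [(x, y, z)] else [])))"
    using ready_simps[of m]
    by (auto simp: print_prog_def if_bad_def same_def view_def key_of_def fun_eq_iff)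
qed (simp add: print_prog_def if_bad_def)

lemma fold_views:
  "fold (\<lambda>t (K, c, out). (g t K, c, out)) xs (K, c, out) = (fold g xs K, c, out)"
  "fold (\<lambda>t (K, c, out). (K, c + (if bad K t then 1 else 0), out)) xs (K, d, out) =
     (K, d + int (length (filter (bad K) xs)), out)"
  "fold (\<lambda>t (K, c, out). (K, c, out @ (if bad K t then enc [t] else []))) xs (K, d, out) =
     (K, d, out @ enc (filter (bad K) xs))"
proof -
  show "fold (\<lambda>t (K, c, out). (g t K, c, out)) xs (K, c, out) = (fold g xs K, c, out)"
    by (induction xs arbitrary: K) auto
  show "fold (\<lambda>t (K, c, out). (K, c + (if bad K t then 1 else 0), out)) xs (K, d, out) =
     (K, d + int (length (filter (bad K) xs)), out)"
    by (induction xs arbitrary: d) auto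
  show "fold (\<lambda>t (K, c, out). (K, c, out @ (if bad K t then enc [t] else []))) xs (K, d, out) =
     (K, d, out @ enc (filter (bad K) xs))"
    by (induction xs arbitrary: out) auto
qed

text \<open>Shared by the key initialisation and both search loops. The invariant \<open>J\<close>
  must ignore the loop registers, since fetching the next vertex overwrites them; the body in turn
  must preserve pointer and counter.\<close>

lemma reaches_for_vertices:
  assumes regs: "p < 0" "r < 0" "x < 0" "distinct [p, r, x, rBase, rOne]"
    and frame: "\<And>i m out m'. J i m out \<Longrightarrow> (\<And>j. j \<notin> {p, r, x} \<Longrightarrow> m' j = m j) \<Longrightarrow> J i m' out"
    and body: "\<And>i m out. i < length vs \<Longrightarrow> ready m \<Longrightarrow> m x = int (vs ! i) \<Longrightarrow> J i m out \<Longrightarrow>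
      \<exists>m' out'. reaches c (m, out) T (m', out') \<and> J (Suc i) m' out' \<and> ready m' \<and>
        m' p = m p \<and> m' r = m r"
    and m: "ready m" "J 0 m out"
  shows "\<exists>m' out'. reaches (for_vertices p r x c) (m, out) (length vs * (T + 5) + 5) (m', out') \<and>
    J (length vs) m' out' \<and> ready m'"
proof -
  define I where "I = (\<lambda>i (s :: state). ready (fst s) \<and> J i (fst s) (snd s) \<and>
    fst s p = 2 + int i \<and> fst s r = int (length vs - i))"
  have ready_frame: "ready m'" if "ready m" "\<And>j. j \<notin> {p, r, x} \<Longrightarrow> m' j = m j" for m m'
    using that regs unfolding ready_def by auto
  have start: "I 0 (exec (vertices_start p r) (m, out))"
  proof -
    obtain m' where m': "exec (vertices_start p r) (m, out) = (m', out)" "m' p = 2" "m' r = N"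
      "\<And>j. j \<notin> {p, r, x} \<Longrightarrow> m' j = m j"
      using ready_simps[OF m(1)] regs by (simp add: vertices_start_def)
    then show ?thesis
      using ready_frame[OF m(1) m'(4)] frame[OF m(2) m'(4)] by (simp add: I_def)
  qed
  have next_step: "\<exists>s'. reaches (Seq (vertices_next p r x) c) s (4 + T) s' \<and> I (Suc i) s'"
    if i: "i < length vs" and I: "I i s" for i s
  proof -
    obtain m1 out1 where s: "s = (m1, out1)"
      by (cases s)
    have m1: "ready m1" "J i m1 out1" "m1 p = 2 + int i" "m1 r = int (length vs - i)"
      using I s by (auto simp: I_def)
    have "m1 (2 + int i) = int (vs ! i)"
      using input_vertex[OF i] ready_cell[OF m1(1)] by simp
    then obtain m2 where m2: "exec (vertices_next p r x) (m1, out1) = (m2, out1)"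
      "m2 x = int (vs ! i)" "m2 p = 2 + int (Suc i)" "m2 r = int (length vs - Suc i)"
      "\<And>j. j \<notin> {p, r, x} \<Longrightarrow> m2 j = m1 j"
      using m1 ready_simps[OF m1(1)] regs i by (simp add: vertices_next_def of_nat_diff)
    obtain m3 out3 where m3: "reaches c (m2, out1) T (m3, out3)" "J (Suc i) m3 out3" "ready m3"
      "m3 p = m2 p" "m3 r = m2 r"
      using body[OF i ready_frame[OF m1(1) m2(5)] m2(2) frame[OF m1(2) m2(5)]] by blast
    have "reaches (vertices_next p r x) (m1, out1) 4 (m2, out1)"
      using m2(1) by (intro reaches_execI) (simp_all add: vertices_next_def)
    then have "reaches (Seq (vertices_next p r x) c) s (4 + T) (m3, out3)"
      using reaches_Seq m3(1) s by blast
    moreover have "I (Suc i) (m3, out3)"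
      using m2 m3 by (simp add: I_def)
    ultimately show ?thesis by blast
  qed
  have "\<exists>s'. reaches (WhilePos r (Seq (vertices_next p r x) c)) (exec (vertices_start p r) (m, out))
      (length vs * (4 + T + 1) + 1) s' \<and> I (length vs) s'"
    by (rule reaches_WhilePos[OF next_step _ start]) (auto simp: I_def)
  then obtain s' where s': "reaches (WhilePos r (Seq (vertices_next p r x) c))
      (exec (vertices_start p r) (m, out)) (length vs * (4 + T + 1) + 1) s'" "I (length vs) s'"
    by blast
  have "reaches (vertices_start p r) (m, out) 4 (exec (vertices_start p r) (m, out))"
    by (intro reaches_execI) (simp_all add: vertices_start_def)
  then have "reaches (for_vertices p r x c) (m, out) (length vs * (T + 5) + 5) s'"
    unfolding for_vertices_def
    by (rule reaches_mono[OF reaches_Seq[OF _ s'(1)]]) (simp add: algebra_simps)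
  then show ?thesis
    using s'(2) by (cases s') (auto simp: I_def)
qed

lemma reaches_init:
  assumes m: "ready m"
  shows "\<exists>m'. reaches init_prog (m, out) (length vs * 9 + 8) (m', out) \<and> same m m' \<and>
    initial vs (key_of m')"
proof -
  define J where "J = (\<lambda>i m' (out' :: int list). same m m' \<and> out' = out \<and> m' rTmp = N + int i \<and>
    (\<forall>l<i. key_of m' (vs ! l) = N + int l))"
  define m1 where "m1 = m(rTmp := N)"
  have m1: "reaches (block [Const rTmp 0, Add rTmp rTmp 1]) (m, out) 3 (m1, out)"
    using ready_simps[OF m] by (intro reaches_execI) (simp_all add: m1_def)
  have "ready m1" "J 0 m1 out"
    using m by (simp_all add: m1_def ready_def J_def same_def)
  have frame: "J i m'' out'" if "J i m' out'" "\<And>j. j \<notin> {rPtr, rLeft, rX} \<Longrightarrow> m'' j = m' j"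
    for i m' m'' out'
    using that by (simp add: J_def same_def key_of_def)
  have body: "\<exists>m'' out''. reaches init_step (m', out') 4 (m'', out'') \<and> J (Suc i) m'' out'' \<and>
      ready m'' \<and> m'' rPtr = m' rPtr \<and> m'' rLeft = m' rLeft"
    if i: "i < length vs" and m': "ready m'" "m' rX = int (vs ! i)" "J i m' out'" for i m' out'
  proof -
    define m2 where "m2 = m'(rAddr := addr (vs ! i), addr (vs ! i) := m' rTmp, rTmp := m' rTmp + 1)"
    have "exec init_step (m', out') = (m2, out')"
      using m' ready_simps[OF m'(1)] by (simp add: init_step_def m2_def)
    then have "reaches init_step (m', out') 4 (m2, out')"
      by (intro reaches_execI) (simp_all add: init_step_def)
    \<comment> \<open>Distinct vertices have distinct key cells, so the new store spares the keys
      already written.\<close>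
    moreover have "vs ! l \<noteq> vs ! i" if "l < i" for l
      using vs i that by (simp add: nth_eq_iff_index_eq)
    then have "J (Suc i) m2 out'"
      using m'(3) by (auto simp: J_def m2_def same_def key_of_def less_Suc_eq)
    moreover have "ready m2" "m2 rPtr = m' rPtr" "m2 rLeft = m' rLeft"
      using m'(1) by (simp_all add: m2_def ready_def)
    ultimately show ?thesis by blast
  qed
  have "\<exists>m' out'. reaches (for_vertices rPtr rLeft rX init_step) (m1, out)
      (length vs * (4 + 5) + 5) (m', out') \<and> J (length vs) m' out' \<and> ready m'"
    by (rule reaches_for_vertices[where x = rX and J = J, OF _ _ _ _ frame body \<open>ready m1\<close> \<open>J 0 m1 out\<close>]) simp_all
  then obtain m' out' where "reaches (for_vertices rPtr rLeft rX init_step) (m1, out)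
      (length vs * (4 + 5) + 5) (m', out')" "J (length vs) m' out'"
    by blast
  then have m': "reaches (for_vertices rPtr rLeft rX init_step) (m1, out) (length vs * 9 + 5) (m', out)"
    "same m m'" "initial vs (key_of m')"
    by (simp_all add: J_def initial_def)
  have "reaches init_prog (m, out) (3 + (length vs * 9 + 5)) (m', out)"
    unfolding init_prog_def using m1 m'(1) by (rule reaches_Seq)
  then have "reaches init_prog (m, out) (length vs * 9 + 8) (m', out)"
    by (rule reaches_mono) simp
  then show ?thesis
    using m'(2,3) by blast
qed

section \<open>One attempt for a fixed pair of vertices\<close>

definition valid :: "int list \<Rightarrow> bool" where
  "valid out \<longleftrightarrow> (\<exists>K. inj_on K V \<and> int (length (filter (bad K) ts)) \<le> k \<and>
     out = 1 # int (length (filter (bad K) ts)) # enc (filter (bad K) ts))"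

text \<open>One initial \<open>K\<close> suffices as evidence, because
  \<open>few_bad_if_edition\<close> bounds the count for all of them.\<close>

definition fails :: "nat \<Rightarrow> nat \<Rightarrow> bool" where
  "fails v u \<longleftrightarrow> (\<exists>K. initial vs K \<and> int (length (filter (bad (keys v u N ts K)) ts)) > k)"

lemma costs: "cost flip_prog \<le> 40" "cost push_prog \<le> 40" "cost count_prog \<le> 40"
  "cost print_prog \<le> 40"
  by (simp_all add: flip_prog_def flip_end_def push_prog_def push_end_def count_prog_def
      print_prog_def if_bad_def if_eq_def)

lemma reaches_pass:
  assumes c: "implements c v u f" "cost c \<le> 40"
    and m: "ready m" "m rV = int v" "m rU = int u"
    and f: "fold f ts (view (m, out)) = (K, d, out')"
  shows "\<exists>m'. reaches (for_triples c) (m, out) (length ts * 49 + 6) (m', out') \<and>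
    same m m' \<and> key_of m' = K \<and> m' rCount = d"
proof -
  obtain m' out'' where m': "reaches (for_triples c) (m, out) (length ts * (cost c + 9) + 6) (m', out'')"
    "same m m'" "view (m', out'') = (K, d, out')"
    using reaches_for_triples[OF c(1) m, of out] f by auto
  have "reaches (for_triples c) (m, out) (length ts * 49 + 6) (m', out'')"
    using m'(1) by (rule reaches_mono) (use c(2) in simp)
  then show ?thesis
    using m'(2,3) by (intro exI[of _ m']) (simp add: view_def)
qed

lemma reaches_report:
  assumes m: "ready m" "m rV = int v" "m rU = int u"
    and K: "key_of m = K" "inj_on K V" "m rCount = int (length (filter (bad K) ts))" "m rCount \<le> k"
  shows "\<exists>m' out. reaches report_prog (m, []) (length ts * 49 + 10) (m', out) \<and>
    (\<forall>j > -9. m' j = m j) \<and> m' rDone = 1 \<and> valid out"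
proof -
  define out where "out = [1, m rCount]"
  have "reaches (block [Print rOne, Print rCount]) (m, []) 3 (m, out)"
    using ready_simps[OF m(1)] by (intro reaches_execI) (simp_all add: out_def)
  moreover have "fold (\<lambda>t (K, c, out). (K, c, out @ (if bad K t then enc [t] else []))) ts
      (view (m, out)) = (K, m rCount, out @ enc (filter (bad K) ts))"
    unfolding view_def by (simp add: fold_views K(1) del: enc_simps)
  then obtain m1 where m1: "reaches (for_triples print_prog) (m, out) (length ts * 49 + 6)
      (m1, out @ enc (filter (bad K) ts))" "same m m1"
    using reaches_pass[OF implements_print costs(4) m] by blast
  moreover have "reaches (Const rDone 1) (m1, out @ enc (filter (bad K) ts)) 1
      (m1(rDone := 1), out @ enc (filter (bad K) ts))"
    by (intro reaches_execI) simp_all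
  ultimately have "reaches report_prog (m, []) (3 + (length ts * 49 + 6 + 1))
      (m1(rDone := 1), out @ enc (filter (bad K) ts))"
    unfolding report_prog_def by (intro reaches_Seq)
  then have "reaches report_prog (m, []) (length ts * 49 + 10)
      (m1(rDone := 1), out @ enc (filter (bad K) ts))"
    by (rule reaches_mono) simp
  moreover have "valid (out @ enc (filter (bad K) ts))"
    unfolding valid_def out_def using K by auto
  moreover have "\<forall>j > -9. (m1(rDone := 1)) j = m j"
    using sameD[OF m1(2)] by simp
  ultimately show ?thesis
    by (metis fun_upd_same)
qed

text \<open>Success needs only that the keys are distinct, whatever the pair; failure leaves the
  output empty and records a count above \<open>k\<close>. The bound \<open>-9\<close> on preserved
  cells excludes \<open>rDone\<close>, which an attempt may set.\<close>

lemma reaches_attempt: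
  assumes m: "ready m" "m rV = int v" "m rU = int u"
  shows "\<exists>m' out. reaches attempt_prog (m, []) (length vs * 9 + length ts * 196 + 60) (m', out) \<and>
    (\<forall>j > -9. m' j = m j) \<and>
    (m' rDone = m rDone \<and> out = [] \<and> fails v u \<or> m' rDone = 1 \<and> valid out)"
proof -
  obtain m1 where m1: "reaches init_prog (m, []) (length vs * 9 + 8) (m1, [])" "same m m1"
    "initial vs (key_of m1)"
    using reaches_init[OF m(1)] by blast
  note cells = m sameD[OF m1(2)]
  have "ready m1" "m1 rV = int v" "m1 rU = int u"
    using ready_same[OF m(1) m1(2)] cells by simp_all
  define K where "K = key_of m1"
  define m2 where "m2 = fst (exec centre_prog (m1, []))"
  have "exec centre_prog (m1, []) = (m2, [])"
    by (simp add: centre_prog_def m2_def prod_eq_iff)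
  have m2: "reaches centre_prog (m1, []) 5 (m2, [])"
    using \<open>exec centre_prog (m1, []) = (m2, [])\<close>
    by (intro reaches_execI) (simp_all add: centre_prog_def)
  have "key_of m2 = K(v := K v - N)" "same m1 m2"
    using ready_simps[OF \<open>ready m1\<close>] \<open>m1 rV = int v\<close>
    by (simp_all add: m2_def centre_prog_def K_def key_of_def same_def fun_eq_iff)
  have "same m m2"
    using m1(2) \<open>same m1 m2\<close> by (rule same_trans)
  have m2': "ready m2" "m2 rV = int v" "m2 rU = int u"
    using ready_same[OF m(1) \<open>same m m2\<close>] m sameD[OF \<open>same m m2\<close>] by simp_all
  have "fold (\<lambda>t (K, c, out). (flip v u N t K, c, out)) ts (view (m2, [])) =
      (fold (flip v u N) ts (K(v := K v - N)), m2 rCount, [])"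
    by (simp only: view_def fst_conv snd_conv fold_views \<open>key_of m2 = _\<close>)
  then obtain m3 where m3: "reaches (for_triples flip_prog) (m2, []) (length ts * 49 + 6) (m3, [])"
    "same m2 m3" "key_of m3 = fold (flip v u N) ts (K(v := K v - N))"
    using reaches_pass[OF implements_flip costs(1) m2'] by blast
  have "same m m3"
    using \<open>same m m2\<close> m3(2) by (rule same_trans)
  have m3': "ready m3" "m3 rV = int v" "m3 rU = int u"
    using ready_same[OF m(1) \<open>same m m3\<close>] m sameD[OF \<open>same m m3\<close>] by simp_all
  define K' where "K' = keys v u N ts K"
  have "fold (\<lambda>t (K, c, out). (push v N t K, c, out)) ts (view (m3, [])) = (K', m3 rCount, [])"
    by (simp only: view_def fst_conv snd_conv fold_views m3(3) K'_def keys_def)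
  then obtain m4 where m4: "reaches (for_triples push_prog) (m3, []) (length ts * 49 + 6) (m4, [])"
    "same m3 m4" "key_of m4 = K'"
    using reaches_pass[OF implements_push costs(2) m3'] by blast
  define m5 where "m5 = m4(rCount := 0)"
  have m5: "reaches (Const rCount 0) (m4, []) 1 (m5, [])"
    by (intro reaches_execI) (simp_all add: m5_def)
  have "same m4 m5" "key_of m5 = K'"
    using m4(3) by (simp_all add: m5_def same_def key_of_def)
  have "same m m5"
    using \<open>same m m3\<close> m4(2) \<open>same m4 m5\<close> same_trans by blast
  have m5': "ready m5" "m5 rV = int v" "m5 rU = int u"
    using ready_same[OF m(1) \<open>same m m5\<close>] m sameD[OF \<open>same m m5\<close>] by simp_all
  let ?n = "int (length (filter (bad K') ts))"
  have "fold (\<lambda>t (K, c, out). (K, c + (if bad K t then 1 else 0), out)) ts (view (m5, [])) =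
      (K', ?n, [])"
    by (simp add: view_def fold_views \<open>key_of m5 = K'\<close>) (simp add: m5_def)
  then obtain m6 where m6: "reaches (for_triples count_prog) (m5, []) (length ts * 49 + 6) (m6, [])"
    "same m5 m6" "key_of m6 = K'" "m6 rCount = ?n"
    using reaches_pass[OF implements_count costs(3) m5'] by blast
  have "same m m6"
    using \<open>same m m5\<close> m6(2) by (rule same_trans)
  have "m6 0 = k" "m6 rOne = 1"
    using ready_simps[OF ready_same[OF m(1) \<open>same m m6\<close>]] by simp_all
  define m7 where "m7 = m6(rTmp := k - ?n + 1)"
  have m7: "reaches (block [Sub rTmp 0 rCount, Add rTmp rTmp rOne]) (m6, []) 3 (m7, [])"
    using m6(4) \<open>m6 0 = k\<close> \<open>m6 rOne = 1\<close> by (intro reaches_execI) (simp_all add: m7_def)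
  have "same m6 m7" "key_of m7 = K'" "m7 rCount = ?n"
    using m6(3,4) by (simp_all add: m7_def same_def key_of_def)
  have "same m m7"
    using \<open>same m m6\<close> \<open>same m6 m7\<close> by (rule same_trans)
  have m7': "ready m7" "m7 rV = int v" "m7 rU = int u"
    using ready_same[OF m(1) \<open>same m m7\<close>] m sameD[OF \<open>same m m7\<close>] by simp_all
  have "\<exists>m' out. reaches (IfPos rTmp report_prog Skip) (m7, []) (1 + (length ts * 49 + 10)) (m', out) \<and>
      (\<forall>j > -9. m' j = m7 j) \<and>
      (m' rDone = m7 rDone \<and> out = [] \<and> fails v u \<or> m' rDone = 1 \<and> valid out)"
  proof (cases "?n \<le> k")
    case True
    have "inj_on K' V"
      unfolding K'_def using m1(3) by (intro inj_on_keys) (simp add: K_def)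
    then obtain m' out where m': "reaches report_prog (m7, []) (length ts * 49 + 10) (m', out)"
      "\<forall>j > -9. m' j = m7 j" "m' rDone = 1" "valid out"
      using reaches_report[OF m7' \<open>key_of m7 = K'\<close>] True \<open>m7 rCount = ?n\<close> by auto
    moreover have "m7 rTmp > 0"
      using True by (simp add: m7_def)
    then have "reaches (IfPos rTmp report_prog Skip) (m7, []) (1 + (length ts * 49 + 10)) (m', out)"
      using m'(1) by (intro reaches_IfPos) simp
    ultimately show ?thesis by blast
  next
    case False
    then have "fails v u"
      using m1(3) unfolding fails_def K'_def K_def by force
    moreover have "reaches Skip (m7, []) (length ts * 49 + 10) (m7, [])"
      by (intro reaches_execI) simp_all
    then have "reaches (IfPos rTmp report_prog Skip) (m7, []) (1 + (length ts * 49 + 10)) (m7, [])"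
      using False by (intro reaches_IfPos) (simp add: m7_def)
    ultimately show ?thesis by blast
  qed
  then obtain m' out where m': "reaches (IfPos rTmp report_prog Skip) (m7, [])
      (1 + (length ts * 49 + 10)) (m', out)" "\<forall>j > -9. m' j = m7 j"
      "m' rDone = m7 rDone \<and> out = [] \<and> fails v u \<or> m' rDone = 1 \<and> valid out"
    by blast
  have "reaches attempt_prog (m, []) (length vs * 9 + 8 + (5 + (length ts * 49 + 6 +
      (length ts * 49 + 6 + (1 + (length ts * 49 + 6 + (3 + (1 + (length ts * 49 + 10))))))))) (m', out)"
    unfolding attempt_prog_def
    by (intro reaches_Seq[OF m1(1)] reaches_Seq[OF m2] reaches_Seq[OF m3(1)] reaches_Seq[OF m4(1)]
        reaches_Seq[OF m5] reaches_Seq[OF m6(1)] reaches_Seq[OF m7] m'(1))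
  \<comment> \<open>The additive constants sum to \<open>46\<close>; \<open>60\<close> is a rounded
    bound.\<close>
  then have "reaches attempt_prog (m, []) (length vs * 9 + length ts * 196 + 60) (m', out)"
    by (rule reaches_mono) simp
  moreover have "\<forall>j > -9. m' j = m j" "m7 rDone = m rDone"
    using m'(2) sameD[OF \<open>same m m7\<close>] by simp_all
  ultimately show ?thesis
    using m'(3) by auto
qed

section \<open>The search over all pairs of vertices\<close>

definition progress :: "(nat \<times> nat) set \<Rightarrow> memory \<Rightarrow> int list \<Rightarrow> bool" where
  "progress P m out \<longleftrightarrow> m rDone = 0 \<and> out = [] \<and> (\<forall>(v, u)\<in>P. fails v u) \<or> m rDone = 1 \<and> valid out"

text \<open>Once \<open>rDone\<close> is \<open>1\<close>, \<open>progress\<close> no longer depends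
  on \<open>P\<close>, so a skipped pair may still be inserted. Otherwise the output is empty, as
  \<open>reaches_attempt\<close> requires.\<close>

lemma reaches_guarded_attempt:
  assumes m: "ready m" "m rV = int v" "m rU = int u" and P: "progress P m out"
  shows "\<exists>m' out'. reaches (IfPos rDone Skip attempt_prog) (m, out)
      (length vs * 9 + length ts * 196 + 61) (m', out') \<and>
    (\<forall>j > -9. m' j = m j) \<and> progress (insert (v, u) P) m' out'"
proof (cases "m rDone = 0")
  case True
  then have "out = []" "\<forall>(v, u)\<in>P. fails v u"
    using P by (auto simp: progress_def)
  moreover obtain m' out' where m': "reaches attempt_prog (m, [])
      (length vs * 9 + length ts * 196 + 60) (m', out')"
    "\<forall>j > -9. m' j = m j"
    "m' rDone = m rDone \<and> out' = [] \<and> fails v u \<or> m' rDone = 1 \<and> valid out'"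
    using reaches_attempt[OF m] by blast
  moreover have "reaches (IfPos rDone Skip attempt_prog) (m, [])
      (1 + (length vs * 9 + length ts * 196 + 60)) (m', out')"
    using True m'(1) by (intro reaches_IfPos) simp
  then have "reaches (IfPos rDone Skip attempt_prog) (m, [])
      (length vs * 9 + length ts * 196 + 61) (m', out')"
    by (rule reaches_mono) simp
  ultimately show ?thesis
    using True by (intro exI[of _ m'] exI[of _ out']) (auto simp: progress_def)
next
  case False
  then have "m rDone = 1" "valid out"
    using P by (auto simp: progress_def)
  moreover have "reaches Skip (m, out) (length vs * 9 + length ts * 196 + 60) (m, out)"
    by (intro reaches_execI) simp_all
  then have "reaches (IfPos rDone Skip attempt_prog) (m, out)
      (1 + (length vs * 9 + length ts * 196 + 60)) (m, out)"
    using \<open>m rDone = 1\<close> by (intro reaches_IfPos) simp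
  then have "reaches (IfPos rDone Skip attempt_prog) (m, out)
      (length vs * 9 + length ts * 196 + 61) (m, out)"
    by (rule reaches_mono) simp
  ultimately show ?thesis
    by (intro exI[of _ m] exI[of _ out]) (auto simp: progress_def)
qed

lemma ready_frame: "ready m \<Longrightarrow> \<forall>j > -9. m' j = m j \<Longrightarrow> ready m'"
  by (simp add: ready_def)

definition inner_time :: nat where
  "inner_time = length vs * (length vs * 9 + length ts * 196 + 66) + 5"

lemma reaches_inner:
  assumes m: "ready m" "m rV = int v" and P: "progress P m out"
  shows "\<exists>m' out'. reaches (for_vertices rPtrU rLeftU rU (IfPos rDone Skip attempt_prog)) (m, out)
      inner_time (m', out') \<and> ready m' \<and> m' rPtrV = m rPtrV \<and> m' rLeftV = m rLeftV \<and>
    progress (P \<union> {v} \<times> V) m' out'"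
proof -
  define J where "J = (\<lambda>i m' out'. progress (P \<union> {v} \<times> set (take i vs)) m' out' \<and>
    m' rV = int v \<and> m' rPtrV = m rPtrV \<and> m' rLeftV = m rLeftV)"
  have frame: "J i m'' out'" if "J i m' out'" "\<And>j. j \<notin> {rPtrU, rLeftU, rU} \<Longrightarrow> m'' j = m' j"
    for i m' m'' out'
    using that by (simp add: J_def progress_def)
  have body: "\<exists>m'' out''. reaches (IfPos rDone Skip attempt_prog) (m', out')
      (length vs * 9 + length ts * 196 + 61) (m'', out'') \<and> J (Suc i) m'' out'' \<and>
      ready m'' \<and> m'' rPtrU = m' rPtrU \<and> m'' rLeftU = m' rLeftU"
    if i: "i < length vs" and m': "ready m'" "m' rU = int (vs ! i)" "J i m' out'" for i m' out'
  proof -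
    obtain m'' out'' where "reaches (IfPos rDone Skip attempt_prog) (m', out')
        (length vs * 9 + length ts * 196 + 61) (m'', out'')" "\<forall>j > -9. m'' j = m' j"
      "progress (insert (v, vs ! i) (P \<union> {v} \<times> set (take i vs))) m'' out''"
      using reaches_guarded_attempt[OF m'(1) _ m'(2)] m'(3) unfolding J_def by blast
    moreover have "insert (v, vs ! i) (P \<union> {v} \<times> set (take i vs)) = P \<union> {v} \<times> set (take (Suc i) vs)"
      using i by (auto simp: take_Suc_conv_app_nth)
    ultimately show ?thesis
      using m'(3) ready_frame[OF m'(1)] unfolding J_def
      by (intro exI[of _ m''] exI[of _ out'']) simp
  qed
  have J0: "J 0 m out"
    using m P by (simp add: J_def)
  have "\<exists>m' out'. reaches (for_vertices rPtrU rLeftU rU (IfPos rDone Skip attempt_prog)) (m, out)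
      (length vs * (length vs * 9 + length ts * 196 + 61 + 5) + 5) (m', out') \<and>
      J (length vs) m' out' \<and> ready m'"
    by (rule reaches_for_vertices[where x = rU and J = J, OF _ _ _ _ frame body m(1) J0]) simp_all
  then obtain m' out' where "reaches (for_vertices rPtrU rLeftU rU (IfPos rDone Skip attempt_prog)) (m, out)
      (length vs * (length vs * 9 + length ts * 196 + 61 + 5) + 5) (m', out')"
      "J (length vs) m' out'" "ready m'"
    by blast
  moreover have "length vs * (length vs * 9 + length ts * 196 + 61 + 5) + 5 = inner_time"
    by (simp add: inner_time_def algebra_simps)
  ultimately show ?thesis
    by (intro exI[of _ m'] exI[of _ out']) (simp add: J_def)
qed

lemma reaches_outer:
  assumes m: "ready m" and P: "progress {} m out"
  shows "\<exists>m' out'. reaches (for_vertices rPtrV rLeftV rV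
      (for_vertices rPtrU rLeftU rU (IfPos rDone Skip attempt_prog))) (m, out)
      (length vs * (inner_time + 5) + 5) (m', out') \<and> progress (V \<times> V) m' out'"
proof -
  define J where "J = (\<lambda>i. progress (set (take i vs) \<times> V))"
  have frame: "J i m'' out'" if "J i m' out'" "\<And>j. j \<notin> {rPtrV, rLeftV, rV} \<Longrightarrow> m'' j = m' j"
    for i m' m'' out'
    using that by (simp add: J_def progress_def)
  have body: "\<exists>m'' out''. reaches (for_vertices rPtrU rLeftU rU (IfPos rDone Skip attempt_prog)) (m', out')
      inner_time (m'', out'') \<and> J (Suc i) m'' out'' \<and>
      ready m'' \<and> m'' rPtrV = m' rPtrV \<and> m'' rLeftV = m' rLeftV"
    if i: "i < length vs" and m': "ready m'" "m' rV = int (vs ! i)" "J i m' out'" for i m' out'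
  proof -
    have "set (take i vs) \<times> V \<union> {vs ! i} \<times> V = set (take (Suc i) vs) \<times> V"
      using i by (auto simp: take_Suc_conv_app_nth)
    then show ?thesis
      using reaches_inner[OF m'(1,2) m'(3)[unfolded J_def]] by (auto simp: J_def)
  qed
  have J0: "J 0 m out"
    using P by (simp add: J_def)
  have "\<exists>m' out'. reaches (for_vertices rPtrV rLeftV rV
      (for_vertices rPtrU rLeftU rU (IfPos rDone Skip attempt_prog))) (m, out)
      (length vs * (inner_time + 5) + 5) (m', out') \<and> J (length vs) m' out' \<and> ready m'"
    by (rule reaches_for_vertices[where x = rV and J = J, OF _ _ _ _ frame body m J0]) simp_all
  then show ?thesis
    unfolding J_def by auto
qed

lemma reaches_main:
  "\<exists>m out. reaches main_prog (load_input ws, []) (length vs * (inner_time + 5) + 12) (m, out) \<and>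
     (valid out \<or> out = [0] \<and> (\<forall>v\<in>V. \<forall>u\<in>V. fails v u))"
proof -
  define m0 where "m0 = (load_input ws)(rBase := -100, rOne := 1)"
  have m0: "reaches (block [Const rBase (-100), Const rOne 1]) (load_input ws, []) 3 (m0, [])"
    by (intro reaches_execI) (simp_all add: m0_def)
  \<comment> \<open>Cells outside the input start at \<open>0\<close>, so \<open>rDone\<close> is
    initially cleared.\<close>
  have "ready m0" "progress {} m0 []"
    by (simp_all add: m0_def ready_def progress_def load_input_def)
  then obtain m1 out1 where m1: "reaches (for_vertices rPtrV rLeftV rV
      (for_vertices rPtrU rLeftU rU (IfPos rDone Skip attempt_prog))) (m0, [])
      (length vs * (inner_time + 5) + 5) (m1, out1)" "progress (V \<times> V) m1 out1"
    using reaches_outer by blast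
  define s where "s = exec (IfPos rDone Skip (block [Const rTmp 0, Print rTmp])) (m1, out1)"
  have s: "reaches (IfPos rDone Skip (block [Const rTmp 0, Print rTmp])) (m1, out1) 4 s"
    by (intro reaches_execI) (simp_all add: s_def)
  have "reaches main_prog (load_input ws, []) (3 + (length vs * (inner_time + 5) + 5 + 4)) s"
    unfolding main_prog_def by (intro reaches_Seq[OF m0] reaches_Seq[OF m1(1)] s)
  then have "reaches main_prog (load_input ws, []) (length vs * (inner_time + 5) + 12) s"
    by (rule reaches_mono) simp
  moreover have "valid (snd s) \<or> snd s = [0] \<and> (\<forall>v\<in>V. \<forall>u\<in>V. fails v u)"
    using m1(2) unfolding progress_def s_def by auto
  ultimately show ?thesis
    by (cases s) auto
qed

section \<open>Running time and correctness of the answers\<close>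

lemma time_bound: "length vs * (inner_time + 5) + 12 \<le> poly time_poly (bit_size ws)"
proof -
  define L where "L = bit_size ws"
  have L: "length vs \<le> L" "length ts \<le> L"
    using length_le_bit_size[of ws] by (simp_all add: L_def length_ws)
  have "inner_time \<le> L * (L * 9 + L * 196 + 66) + 5"
    unfolding inner_time_def using L by (intro add_mono mult_le_mono) auto
  then have "length vs * (inner_time + 5) + 12 \<le> L * (L * (L * 9 + L * 196 + 66) + 5 + 5) + 12"
    using L by (intro add_mono mult_le_mono) auto
  also have "\<dots> = poly time_poly L"
    by (simp add: time_poly_def algebra_simps)
  finally show ?thesis
    by (simp add: L_def)
qed

lemma answers_edition_if_valid:
  assumes "valid out"
  shows "\<exists>F. edition V R F \<and> int (card F) \<le> k \<and> answers_edition F out"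
proof -
  obtain K where K: "inj_on K V" "int (length (filter (bad K) ts)) \<le> k"
    "out = 1 # int (length (filter (bad K) ts)) # enc (filter (bad K) ts)"
    using assms unfolding valid_def by blast
  let ?ts = "filter (bad K) ts"
  have "distinct (map btw_of ?ts)"
    using ts by (rule distinct_map_filter)
  then have "card (btw_of ` set ?ts) = length ?ts"
    by (metis distinct_card length_map list.set_map)
  moreover have "encodes_triplets (btw_of ` set ?ts) (int (length ?ts) # enc ?ts)"
    unfolding encodes_triplets_def enc_def btw_of_eq[symmetric]
    using \<open>distinct (map btw_of ?ts)\<close> by (intro exI[of _ ?ts]) simp
  ultimately show ?thesis
    using edition_if_inj[OF K(1)] K(2,3) unfolding answers_edition_def by auto
qed

text \<open>An edition within the bound would give a pair whose count is at most
  \<open>card F \<le> k\<close> for all initial keys, while every pair has a recorded count above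
  \<open>k\<close>.\<close>

lemma no_edition_if_fails:
  assumes small: "5 * k < N" and fails: "\<And>v u. v \<in> V \<Longrightarrow> u \<in> V \<Longrightarrow> fails v u"
  shows "\<not> (\<exists>F. edition V R F \<and> int (card F) \<le> k)"
proof
  assume "\<exists>F. edition V R F \<and> int (card F) \<le> k"
  then obtain F where F: "edition V R F" "int (card F) \<le> k"
    by blast
  \<comment> \<open>Cardinalities are nonnegative, so \<open>k \<ge> 0\<close> and
    \<open>3 * card F \<le> 5 * k\<close>.\<close>
  then have "3 * card F < length vs"
    using small by linarith
  then obtain v u where "v \<in> V" "u \<in> V"
    "\<And>K. initial vs K \<Longrightarrow> length (filter (bad (keys v u N ts K)) ts) \<le> card F"
    using few_bad_if_edition[OF F(1)] by blast
  then show False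
    using fails[of v u] F(2) unfolding fails_def by fastforce
qed

end

theorem theorem3:
  "\<exists>(alg :: prog) (p :: nat poly).
     \<forall>(V :: nat set) (R :: nat triplet set) (k :: int) (ws :: int list).
       finite V \<longrightarrow> dense_triplets V R \<longrightarrow> real_of_int k < real (card V) / 5 \<longrightarrow>
       encodes_instance V R k ws \<longrightarrow>
       (\<exists>out. outputs_within alg ws (poly p (bit_size ws)) out \<and>
          ((\<exists>F. edition V R F \<and> int (card F) \<le> k \<and> answers_edition F out) \<or>
           (answers_none out \<and> \<not> (\<exists>F. edition V R F \<and> int (card F) \<le> k))))"
proof (intro exI[of _ main_prog] exI[of _ time_poly] allI impI)
  fix V :: "nat set" and R :: "nat triplet set" and k :: int and ws :: "int list"
  assume dense: "dense_triplets V R" and k: "real_of_int k < real (card V) / 5"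
    and "encodes_instance V R k ws"
  then obtain vs us where list_V: "distinct vs" "set vs = V" and "encodes_triplets R us"
    and ws: "ws = k # int (length vs) # map int vs @ us"
    unfolding encodes_instance_def by blast
  then obtain ts where list_R: "distinct (map btw_of ts)" "set (map btw_of ts) = R"
    and us: "us = int (length ts) # enc ts"
    unfolding encodes_triplets_def enc_def btw_of_eq by blast
  interpret encoded_instance vs ts k
    using list_V list_R dense by unfold_locales simp_all
  have ws_eq: "local.ws = ws"
    by (simp add: ws_def ws us)
  have R: "btw_of ` set ts = R"
    using list_R by simp
  have "5 * real_of_int k < real (length vs)"
    using k distinct_card[OF list_V(1)] unfolding list_V(2) by simp
  then have "5 * k < int (length vs)"
    by linarith
  obtain m out where out: "reaches main_prog (load_input ws, []) (length vs * (inner_time + 5) + 12) (m, out)"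
    "valid out \<or> out = [0] \<and> (\<forall>v\<in>V. \<forall>u\<in>V. fails v u)"
    using reaches_main unfolding ws_eq list_V(2) by blast
  have "outputs_within main_prog ws (poly time_poly (bit_size ws)) out"
    using reaches_mono[OF out(1)] time_bound unfolding ws_eq reaches_def outputs_within_def by blast
  moreover have "(\<exists>F. edition V R F \<and> int (card F) \<le> k \<and> answers_edition F out) \<or>
      (answers_none out \<and> \<not> (\<exists>F. edition V R F \<and> int (card F) \<le> k))"
    using out(2) answers_edition_if_valid[of out] no_edition_if_fails[OF \<open>5 * k < int (length vs)\<close>]
    unfolding list_V(2) R answers_none_def by blast
  ultimately show "\<exists>out. outputs_within main_prog ws (poly time_poly (bit_size ws)) out \<and>
      ((\<exists>F. edition V R F \<and> int (card F) \<le> k \<and> answers_edition F out) \<or>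
       (answers_none out \<and> \<not> (\<exists>F. edition V R F \<and> int (card F) \<le> k)))"
    by blast
qed

end
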